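(* Let $\mathfrak{g}=\mathfrak{s}_1\oplus\cdots\oplus\mathfrak{s}_\ell$ be a finite-dimensional complex semisimple Lie algebra, where $\mathfrak{s}_1,\dots,\mathfrak{s}_\ell$ are simple ideals of $\mathfrak{g}$. Then $$\mu(\mathfrak{g})=\mu(\mathfrak{s}_1)+\cdots+\mu(\mathfrak{s}_\ell).$$
   Context: For a finite-dimensional complex Lie algebra $\mathfrak{g}$, $\mu(\mathfrak{g})$ denotes the minimal dimension of a faithful complex linear representation of $\mathfrak{g}$. *)

theory Defs
  imports Complex_Main "HOL-Library.FuncSet" "HOL-Library.Function_Algebras"
begin

text \<open>
  A complex Lie algebra is a subspace \<open>L\<close> of some complex vector space, with a bracket that only
  matters on \<open>L\<close>. Keeping the carrier explicit makes ideals Lie algebras in their own right, with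
  the same scalar multiplication and bracket.
\<close>

locale lie_algebra = vector_space scale
  for scale :: "complex \<Rightarrow> 'a::ab_group_add \<Rightarrow> 'a" +
  fixes L :: "'a set" and bracket :: "'a \<Rightarrow> 'a \<Rightarrow> 'a"
  assumes subspace_carrier: "subspace L"
    and bracket_closed: "x \<in> L \<Longrightarrow> y \<in> L \<Longrightarrow> bracket x y \<in> L"
    and bracket_add_left:
      "x \<in> L \<Longrightarrow> y \<in> L \<Longrightarrow> z \<in> L \<Longrightarrow> bracket (x + y) z = bracket x z + bracket y z"
    and bracket_add_right:
      "x \<in> L \<Longrightarrow> y \<in> L \<Longrightarrow> z \<in> L \<Longrightarrow> bracket x (y + z) = bracket x y + bracket x z"
    and bracket_scale_left:
      "x \<in> L \<Longrightarrow> y \<in> L \<Longrightarrow> bracket (scale c x) y = scale c (bracket x y)"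
    and bracket_scale_right:
      "x \<in> L \<Longrightarrow> y \<in> L \<Longrightarrow> bracket x (scale c y) = scale c (bracket x y)"
    and bracket_self: "x \<in> L \<Longrightarrow> bracket x x = 0"
    and jacobi: "x \<in> L \<Longrightarrow> y \<in> L \<Longrightarrow> z \<in> L \<Longrightarrow>
      bracket x (bracket y z) + bracket y (bracket z x) + bracket z (bracket x y) = 0"
begin

definition lie_ideal :: "'a set \<Rightarrow> bool"
  where "lie_ideal I \<longleftrightarrow> subspace I \<and> I \<subseteq> L \<and> (\<forall>x\<in>L. \<forall>y\<in>I. bracket x y \<in> I)"

definition abelian :: bool
  where "abelian \<longleftrightarrow> (\<forall>x\<in>L. \<forall>y\<in>L. bracket x y = 0)"

primrec derived_series :: "nat \<Rightarrow> 'a set" where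
  "derived_series 0 = L"
| "derived_series (Suc n) =
     span {bracket x y | x y. x \<in> derived_series n \<and> y \<in> derived_series n}"

definition solvable :: bool
  where "solvable \<longleftrightarrow> (\<exists>n. derived_series n = {0})"

definition simple :: bool
  where "simple \<longleftrightarrow> \<not> abelian \<and> (\<forall>I. lie_ideal I \<longrightarrow> I = {0} \<or> I = L)"

text \<open>
  The radical is the largest solvable ideal, so it vanishes exactly if every solvable ideal does.
\<close>

definition semisimple :: bool
  where "semisimple \<longleftrightarrow>
    (\<forall>I. lie_ideal I \<and> lie_algebra.solvable scale I bracket \<longrightarrow> I = {0})"

end

definition finite_dim :: "(complex \<Rightarrow> 'a::ab_group_add \<Rightarrow> 'a) \<Rightarrow> 'a set \<Rightarrow> bool"
  where "finite_dim scale V \<longleftrightarrow> (\<exists>B. finite B \<and> V \<subseteq> module.span scale B)"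

text \<open>
  Every element of \<open>V\<close> is uniquely a sum of one element from each \<open>W i\<close>. The extensional product
  makes the families of summands genuinely unique.
\<close>

definition internal_direct_sum :: "'i set \<Rightarrow> ('i \<Rightarrow> 'a::comm_monoid_add set) \<Rightarrow> 'a set \<Rightarrow> bool"
  where "internal_direct_sum I W V \<longleftrightarrow> bij_betw (\<lambda>f. \<Sum>i\<in>I. f i) (Pi\<^sub>E I W) V"

locale lie_representation =
  lie_algebra scale L bracket + rep: vector_space scaleV
  for scale :: "complex \<Rightarrow> 'a::ab_group_add \<Rightarrow> 'a"
    and L :: "'a set"
    and bracket :: "'a \<Rightarrow> 'a \<Rightarrow> 'a"
    and scaleV :: "complex \<Rightarrow> 'v::ab_group_add \<Rightarrow> 'v" +
  fixes V :: "'v set" and \<rho> :: "'a \<Rightarrow> 'v \<Rightarrow> 'v"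
  assumes subspace_rep: "rep.subspace V"
    and rep_closed: "x \<in> L \<Longrightarrow> v \<in> V \<Longrightarrow> \<rho> x v \<in> V"
    and rep_add_vec: "x \<in> L \<Longrightarrow> v \<in> V \<Longrightarrow> w \<in> V \<Longrightarrow> \<rho> x (v + w) = \<rho> x v + \<rho> x w"
    and rep_scale_vec: "x \<in> L \<Longrightarrow> v \<in> V \<Longrightarrow> \<rho> x (scaleV c v) = scaleV c (\<rho> x v)"
    and rep_add: "x \<in> L \<Longrightarrow> y \<in> L \<Longrightarrow> v \<in> V \<Longrightarrow> \<rho> (x + y) v = \<rho> x v + \<rho> y v"
    and rep_scale: "x \<in> L \<Longrightarrow> v \<in> V \<Longrightarrow> \<rho> (scale c x) v = scaleV c (\<rho> x v)"
    and rep_bracket: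
      "x \<in> L \<Longrightarrow> y \<in> L \<Longrightarrow> v \<in> V \<Longrightarrow> \<rho> (bracket x y) v = \<rho> x (\<rho> y v) - \<rho> y (\<rho> x v)"

text \<open>
  Only the restriction of \<open>\<rho> x\<close> to \<open>V\<close> is an operator of the representation, hence the
  \<^term>\<open>restrict\<close>.
\<close>

locale faithful_lie_representation = lie_representation +
  assumes faithful: "inj_on (\<lambda>x. restrict (\<rho> x) V) L"

definition seq_scale :: "complex \<Rightarrow> (nat \<Rightarrow> complex) \<Rightarrow> nat \<Rightarrow> complex"
  where "seq_scale c f = (\<lambda>i. c * f i)"

lemma vector_space_seq_scale: "vector_space seq_scale"
  by unfold_locales (auto simp: seq_scale_def plus_fun_def algebra_simps)

text \<open>
  HOL cannot quantify over the type of the representation space, so \<open>\<mu>\<close> ranges over the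
  finite-dimensional subspaces of the space of all complex sequences. Lemma \<open>lie_mu_le_dim\<close> below
  shows that a faithful representation on a finite-dimensional space of any type is accounted for.
  By Ado's theorem the set of dimensions is nonempty if \<open>L\<close> is finite-dimensional.
\<close>

definition lie_mu ::
    "(complex \<Rightarrow> 'a::ab_group_add \<Rightarrow> 'a) \<Rightarrow> 'a set \<Rightarrow> ('a \<Rightarrow> 'a \<Rightarrow> 'a) \<Rightarrow> nat"
  where "lie_mu scale L bracket = (LEAST n. \<exists>V \<rho>.
    faithful_lie_representation scale L bracket seq_scale V \<rho> \<and>
    finite_dim seq_scale V \<and> vector_space.dim seq_scale V = n)"

lemma seq_unit_independent:
  "\<not> module.dependent seq_scale (range (\<lambda>(i::nat) j. if j = i then 1 else (0::complex)))"
proof -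
  interpret vector_space seq_scale by (rule vector_space_seq_scale)
  let ?e = "\<lambda>(i::nat) j. if j = i then 1 else (0::complex)"
  have sum_app: "(\<Sum>a\<in>A. h a) j = (\<Sum>a\<in>A. h a j)"
    for A and h :: "(nat \<Rightarrow> complex) \<Rightarrow> nat \<Rightarrow> complex" and j
    by (induction A rule: infinite_finite_induct) auto
  have "u (?e i) = 0"
    if t: "finite t" "t \<subseteq> range ?e" and z: "(\<Sum>v\<in>t. seq_scale (u v) v) = 0" and i: "?e i \<in> t"
    for t u i
  proof -
    have "0 = (\<Sum>v\<in>t. seq_scale (u v) v) i"
      by (simp add: z)
    also have "\<dots> = (\<Sum>v\<in>t. u v * v i)"
      by (simp add: sum_app seq_scale_def)
    also have "\<dots> = (\<Sum>v\<in>t. if v = ?e i then u v else 0)"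
    proof (rule sum.cong)
      fix v assume "v \<in> t"
      then obtain k where "v = ?e k" using t by blast
      then show "u v * v i = (if v = ?e i then u v else 0)"
        by (auto simp: fun_eq_iff)
    qed simp
    also have "\<dots> = u (?e i)"
      using t i by simp
    finally show ?thesis by simp
  qed
  then show ?thesis
    unfolding independent_explicit_module by blast
qed

lemma lie_mu_le_dim:
  assumes rep: "faithful_lie_representation scale L bracket scaleV V \<rho>"
    and fin: "finite_dim scaleV V"
  shows "lie_mu scale L bracket \<le> vector_space.dim scaleV V"
proof -
  interpret R: faithful_lie_representation scale L bracket scaleV V \<rho> by (rule rep)
  interpret S: vector_space seq_scale by (rule vector_space_seq_scale)
  interpret P: vector_space_pair scaleV seq_scale ..
  interpret Q: vector_space_pair seq_scale scaleV ..
  obtain C where C: "finite C" "V \<subseteq> R.rep.span C"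
    using fin unfolding finite_dim_def by blast
  obtain B where B: "B \<subseteq> V" "R.rep.independent B" "V \<subseteq> R.rep.span B"
      "card B = R.rep.dim V"
    using R.rep.basis_exists .
  have finB: "finite B"
    using R.rep.independent_span_bound[of C B] B C by blast
  have spanB: "R.rep.span B = V"
    using B R.rep.span_minimal[OF B(1) R.subspace_rep] by blast
  let ?e = "\<lambda>(i::nat) j. if j = i then 1 else (0::complex)"
  have inj_e: "inj ?e"
    by (rule injI) (metis zero_neq_one)
  obtain b :: "_ \<Rightarrow> nat" where b: "inj_on b B"
    using finB finite_imp_inj_to_nat_seg by metis
  obtain f where f: "Vector_Spaces.linear scaleV seq_scale f" "\<And>x. x \<in> B \<Longrightarrow> f x = ?e (b x)"
    using P.linear_independent_extend[OF B(2), of "\<lambda>x. ?e (b x)"] by blast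
  interpret f: Vector_Spaces.linear scaleV seq_scale f by (rule f(1))
  have injfB: "inj_on f B"
  proof (rule inj_onI)
    fix x y assume xy: "x \<in> B" "y \<in> B" and "f x = f y"
    then have "?e (b x) = ?e (b y)" using f(2) by simp
    then have "b x = b y" by (rule injD[OF inj_e])
    then show "x = y" using inj_onD[OF b] xy by blast
  qed
  have "f ` B \<subseteq> range ?e"
    using f(2) by auto
  then have indep: "S.independent (f ` B)"
    using seq_unit_independent S.dependent_mono by blast
  have injf: "inj_on f V"
    using f.inj_on_span_independent_image[OF indep injfB] spanB by simp
  define W where "W = f ` V"
  have spanW: "W = S.span (f ` B)"
    unfolding W_def using f.span_image spanB by metis
  have dimW: "S.dim W = R.rep.dim V"
    using S.dim_span_eq_card_independent[OF indep] card_image[OF injfB] B(4) spanW by simp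
  have finW: "finite_dim seq_scale W"
    unfolding finite_dim_def using finB spanW by blast
  obtain h where h: "Vector_Spaces.linear seq_scale scaleV h" "\<And>v. v \<in> V \<Longrightarrow> h (f v) = v"
    using P.linear_exists_left_inverse_on[OF f(1) R.subspace_rep injf] by blast
  interpret h: Vector_Spaces.linear seq_scale scaleV h by (rule h(1))
  define \<sigma> where "\<sigma> x w = f (\<rho> x (h w))" for x w
  have hW: "h w \<in> V" if "w \<in> W" for w
    using that h(2) by (auto simp: W_def)
  have "faithful_lie_representation scale L bracket seq_scale W \<sigma>"
  proof unfold_locales
    show "S.subspace W" by (simp add: spanW)
    show "inj_on (\<lambda>x. restrict (\<sigma> x) W) L"
    proof (rule inj_onI)
      fix x y assume xy: "x \<in> L" "y \<in> L" and eq: "restrict (\<sigma> x) W = restrict (\<sigma> y) W"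
      have "\<rho> x v = \<rho> y v" if v: "v \<in> V" for v
      proof -
        have "\<sigma> x (f v) = \<sigma> y (f v)"
          using fun_cong[OF eq, of "f v"] v by (simp add: W_def)
        then have "f (\<rho> x v) = f (\<rho> y v)"
          by (simp add: \<sigma>_def h(2)[OF v])
        then show ?thesis
          using injf R.rep_closed xy v by (meson inj_onD)
      qed
      then have "restrict (\<rho> x) V = restrict (\<rho> y) V" by auto
      then show "x = y" using R.faithful xy by (meson inj_onD)
    qed
  qed (auto simp: \<sigma>_def hW W_def R.rep_closed f.add f.scale f.diff h.add h.scale
        R.rep_add_vec R.rep_scale_vec R.rep_add R.rep_scale R.rep_bracket h(2))
  then show ?thesis
    unfolding lie_mu_def using finW dimW by (intro Least_le) blast
qed

end

theory Submission
  imports Defs "HOL-Computational_Algebra.Fundamental_Theorem_Algebra"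
begin

text \<open>
  Direct sums of faithful representations of the summands give \<open>\<le>\<close>. For \<open>\<ge>\<close>, the \<open>s i\<close> are
  commuting simple Lie algebras acting nontrivially on one space \<open>V\<close>, and
  \<open>\<Sum> \<mu>(s i) \<le> dim V\<close> follows by induction on \<open>dim V\<close>. If \<open>W\<close> is a proper submodule, every \<open>s i\<close>, being
  perfect, acts nontrivially on \<open>W\<close> or on \<open>V / W\<close>. If \<open>V\<close> is irreducible and the index set splits
  into two nonempty parts, then by Schur's lemma neither part acts irreducibly, so a minimal
  submodule for either part has dimension at most \<open>dim V / 2\<close>; the induction hypothesis applies to
  both of these submodules. If there is only one \<open>s i\<close>, its action is faithful. This needs neither
  complete reducibility nor the tensor product description of the irreducible modules.
\<close>

section \<open>Operators on finite-dimensional subspaces\<close>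

locale complex_vector_space = vector_space scale
  for scale :: "complex \<Rightarrow> 'b::ab_group_add \<Rightarrow> 'b" (infixr "*s" 75)
begin

text \<open>The operators of a representation are constrained only on \<open>V\<close>, so linearity
  is relativised to a set. \<open>linear_on_extend\<close> leads back to linear maps of the whole
  type.\<close>

definition linear_on :: "'b set \<Rightarrow> ('b \<Rightarrow> 'b) \<Rightarrow> bool"
  where "linear_on V f \<longleftrightarrow>
    (\<forall>u\<in>V. \<forall>v\<in>V. f (u + v) = f u + f v) \<and> (\<forall>c. \<forall>v\<in>V. f (c *s v) = c *s f v)"

definition stable :: "('b \<Rightarrow> 'b) set \<Rightarrow> 'b set \<Rightarrow> bool"
  where "stable F U \<longleftrightarrow> subspace U \<and> (\<forall>f\<in>F. \<forall>u\<in>U. f u \<in> U)"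

text \<open>\<open>F\<close> is a bare set of operators, so that stability under a part of a family
  and under the whole family are compared by inclusion of sets.\<close>

definition irreducible :: "('b \<Rightarrow> 'b) set \<Rightarrow> 'b set \<Rightarrow> bool"
  where "irreducible F V \<longleftrightarrow>
    stable F V \<and> V \<noteq> {0} \<and> (\<forall>U. stable F U \<and> U \<subseteq> V \<longrightarrow> U = {0} \<or> U = V)"

lemma stable_subspace: "stable F U \<Longrightarrow> subspace U"
  by (simp add: stable_def)

lemma stable_mono: "stable G U \<Longrightarrow> F \<subseteq> G \<Longrightarrow> stable F U"
  by (auto simp: stable_def)

lemma linear_on_add: "linear_on V f \<Longrightarrow> u \<in> V \<Longrightarrow> v \<in> V \<Longrightarrow> f (u + v) = f u + f v"
  and linear_on_scale: "linear_on V f \<Longrightarrow> v \<in> V \<Longrightarrow> f (c *s v) = c *s f v"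
  unfolding linear_on_def by blast+

lemma linear_on_0: "linear_on V f \<Longrightarrow> subspace V \<Longrightarrow> f 0 = 0"
  using linear_on_scale[of V f 0 0] subspace_0 by simp

lemma linear_on_extend:
  assumes f: "linear_on V f" and V: "subspace V"
  shows "\<exists>g. Vector_Spaces.linear scale scale g \<and> (\<forall>v\<in>V. g v = f v)"
proof -
  interpret vector_space_pair scale scale ..
  obtain B where B: "B \<subseteq> V" "independent B" "V \<subseteq> span B"
    by (rule basis_exists[of V])
  obtain g where g: "Vector_Spaces.linear scale scale g" "\<forall>b\<in>B. g b = f b"
    using linear_independent_extend[OF B(2), of f] by blast
  interpret g: Vector_Spaces.linear scale scale g by (rule g(1))
  \<comment> \<open>Membership in \<open>V\<close> is carried through the induction because
    \<open>f\<close> is additive only there.\<close>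
  have "v \<in> V \<and> g v = f v" if "v \<in> span B" for v
    using that
  proof (induction rule: span_induct_alt)
    case base
    then show ?case using subspace_0[OF V] linear_on_0[OF f V] by simp
  next
    case (step c b v)
    then have "b \<in> V" using B(1) by blast
    then show ?case
      using step g(2) by (simp add: V subspace_add subspace_scale linear_on_add[OF f]
          linear_on_scale[OF f] g.add g.scale)
  qed
  then have "\<forall>v\<in>V. g v = f v" using B(3) by auto
  with g(1) show ?thesis by (intro exI[of _ g] conjI)
qed

section \<open>Dimension counts inside a possibly infinite-dimensional ambient space\<close>

lemma finite_dim_subset: "finite_dim scale V \<Longrightarrow> U \<subseteq> V \<Longrightarrow> finite_dim scale U"
  unfolding finite_dim_def by blast

lemma finite_dim_independent:
  assumes "finite_dim scale V" "B \<subseteq> V" "independent B"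
  shows "finite B" "card B \<le> dim V"
proof -
  \<comment> \<open>\<open>C\<close> need not lie in \<open>V\<close> and may have more than
    \<open>dim V\<close> elements. It yields finiteness; the bound comes from exchange against a
    basis \<open>D\<close> of \<open>V\<close>.\<close>
  obtain C where C: "finite C" "V \<subseteq> span C"
    using assms(1) unfolding finite_dim_def by blast
  then show "finite B"
    using independent_span_bound[of C B] assms by blast
  obtain D where D: "D \<subseteq> V" "independent D" "V \<subseteq> span D" "card D = dim V"
    by (rule basis_exists[of V])
  then have "finite D"
    using independent_span_bound[of C D] C by blast
  then show "card B \<le> dim V"
    using independent_span_bound[of D B] D assms by auto
qed

text \<open>A vector of \<open>V\<close> outside \<open>U\<close>, added to a basis of
  \<open>U\<close>, would give an independent set with more than \<open>dim V\<close>
  elements.\<close>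

lemma finite_dim_subspace_eq:
  assumes V: "finite_dim scale V" and U: "subspace U" "U \<subseteq> V" "dim V \<le> dim U"
  shows "U = V"
proof (rule ccontr)
  assume "U \<noteq> V"
  then obtain v where v: "v \<in> V" "v \<notin> U" using U by blast
  obtain B where B: "B \<subseteq> U" "independent B" "U \<subseteq> span B" "card B = dim U"
    by (rule basis_exists[of U])
  have "span B \<subseteq> U" using B(1) U(1) by (rule span_minimal)
  then have "v \<notin> span B" using v by blast
  then have ind: "independent (insert v B)" using B(2) by (rule independent_insertI)
  have "finite B" "card (insert v B) \<le> dim V"
    using finite_dim_independent[OF V] ind B(1,2) U(2) v(1) by auto
  moreover have "v \<notin> B" using v B by blast
  ultimately show False using U(3) B(4) by simp
qed

lemma finite_dim_dim_eq_0:
  assumes "finite_dim scale V" "subspace V" "dim V = 0"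
  shows "V = {0}"
  using finite_dim_subspace_eq[OF assms(1), of "{0}"] assms by (simp add: subspace_0)

text \<open>A basis of \<open>U\<close> has an independent image of the same size. The independence
  is obtained for a globally linear extension \<open>g\<close> of \<open>f\<close>.\<close>

lemma dim_le_of_inj:
  assumes f: "linear_on U f" and U: "subspace U" and W: "finite_dim scale W" "f ` U \<subseteq> W"
    and ker: "\<And>u. u \<in> U \<Longrightarrow> f u = 0 \<Longrightarrow> u = 0"
  shows "dim U \<le> dim W"
proof -
  obtain g where g: "Vector_Spaces.linear scale scale g" "\<forall>u\<in>U. g u = f u"
    using linear_on_extend[OF f U] by blast
  interpret g: Vector_Spaces.linear scale scale g by (rule g(1))
  obtain B where B: "B \<subseteq> U" "independent B" "U \<subseteq> span B" "card B = dim U"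
    by (rule basis_exists[of U])
  have spanB: "span B = U" using span_subspace[OF B(1,3) U] .
  have inj: "inj_on g U"
  proof (rule inj_onI)
    fix x y assume xy: "x \<in> U" "y \<in> U" "g x = g y"
    then have d: "x - y \<in> U" using subspace_diff[OF U] by blast
    have "g (x - y) = 0" using xy(3) by (simp add: g.diff)
    then have "f (x - y) = 0" using g(2) d by simp
    then show "x = y" using ker[OF d] by simp
  qed
  then have "independent (g ` B)"
    using g.independent_injective_image[OF B(2)] spanB by simp
  moreover have "card (g ` B) = card B"
    using inj_on_subset[OF inj B(1)] by (rule card_image)
  moreover have "g ` B \<subseteq> W" using g(2) W(2) B(1) by auto
  ultimately show ?thesis
    using finite_dim_independent(2)[OF W(1), of "g ` B"] B(4) by simp
qed

text \<open>The complement \<open>C\<close> together with \<open>p\<close> serves as a model of the quotient \<open>V / W\<close>.\<close>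

lemma complement_projection:
  assumes V: "subspace V" "finite_dim scale V" and W: "subspace W" "W \<subseteq> V"
  obtains C p where "Vector_Spaces.linear scale scale p" "subspace C" "C \<subseteq> V" "p ` V \<subseteq> C"
    "\<forall>w\<in>W. p w = 0" "\<forall>v\<in>C. p v = v" "\<forall>v\<in>V. v - p v \<in> W"
    "dim V = dim W + dim C"
proof -
  interpret vector_space_pair scale scale ..
  obtain A where A: "A \<subseteq> W" "independent A" "W \<subseteq> span A" "card A = dim W"
    by (rule basis_exists[of W])
  obtain B where B: "A \<subseteq> B" "B \<subseteq> V" "independent B" "V \<subseteq> span B"
    by (rule maximal_independent_subset_extend[of A V]) (use A W in auto)
  obtain p where p: "Vector_Spaces.linear scale scale p"
    "\<forall>b\<in>B. p b = (if b \<in> A then 0 else b)"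
    using linear_independent_extend[OF B(3), of "\<lambda>b. if b \<in> A then 0 else b"] by blast
  interpret p: Vector_Spaces.linear scale scale p by (rule p(1))
  define C where "C = span (B - A)"
  have subC: "subspace C" "C \<subseteq> V"
    unfolding C_def using B(2) span_minimal[OF _ V(1), of "B - A"] by auto
  have spanA: "span A = W" using span_subspace[OF A(1,3) W(1)] .
  have key: "p v \<in> C \<and> v - p v \<in> W" if "v \<in> span B" for v
    using that
  proof (induction rule: span_induct_alt)
    case base
    then show ?case using subC W(1) by (simp add: subspace_0)
  next
    case (step c b v)
    have b: "p b \<in> C" "b - p b \<in> W"
      using p(2) step(1) A(1) by (auto simp: C_def span_zero span_base subspace_0[OF W(1)])
    have "c *s b + v - p (c *s b + v) = c *s (b - p b) + (v - p v)"
      by (simp add: p.add p.scale scale_right_diff_distrib)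
    also have "\<dots> \<in> W" using step b W(1) by (intro subspace_add subspace_scale) auto
    finally show ?case
      using step b subC(1) by (simp add: p.add p.scale subspace_add subspace_scale)
  qed
  have z: "p w = 0" if "w \<in> W" for w
    using that unfolding spanA[symmetric]
    by (induction rule: span_induct_alt) (use B(1) p(2) in \<open>auto simp: p.add p.scale\<close>)
  have i: "p v = v" if "v \<in> C" for v
    using that unfolding C_def
    by (induction rule: span_induct_alt) (use p(2) in \<open>auto simp: p.add p.scale\<close>)
  have fin: "finite B"
    using finite_dim_independent(1)[OF V(2) B(2,3)] .
  have "dim V = card B"
    using basis_card_eq_dim[OF B(2,4,3)] by simp
  moreover have "dim C = card (B - A)"
    unfolding C_def using independent_mono[OF B(3)] by (intro dim_span_eq_card_independent) auto
  moreover have "card B = card A + card (B - A)"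
    using fin B(1) card_Un_disjoint[of A "B - A"] finite_subset[OF B(1)] by (simp add: Un_absorb1)
  ultimately have "dim V = dim W + dim C" using A(4) by simp
  moreover have "p ` V \<subseteq> C" "\<forall>v\<in>V. v - p v \<in> W"
    using key B(4) by auto
  ultimately show thesis
    using z i by (intro that[OF p(1) subC]) auto
qed

section \<open>Minimal stable subspaces\<close>

lemma ex_irreducible:
  assumes "stable F V" "V \<noteq> {0}" "finite_dim scale V"
  obtains U where "U \<subseteq> V" "irreducible F U"
proof -
  let ?P = "\<lambda>U. stable F U \<and> U \<subseteq> V \<and> U \<noteq> {0}"
  have "?P V" using assms by simp
  \<comment> \<open>A nonzero stable subspace of least dimension: a proper stable subspace of it has
    smaller dimension, hence is zero.\<close>
  then obtain U where U: "?P U" "\<And>U'. ?P U' \<Longrightarrow> dim U \<le> dim U'"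
    using ex_has_least_nat[of ?P V dim] by blast
  have "irreducible F U"
    unfolding irreducible_def
  proof (intro conjI allI impI)
    fix U' assume U': "stable F U' \<and> U' \<subseteq> U"
    show "U' = {0} \<or> U' = U"
    proof (rule disjCI)
      assume "U' \<noteq> U"
      then have "\<not> dim U \<le> dim U'"
        using U' finite_dim_subspace_eq[of U U'] finite_dim_subset[OF assms(3), of U] U(1)
          stable_subspace by blast
      then show "U' = {0}" using U U' by blast
    qed
  qed (use U in auto)
  with U that show thesis by blast
qed

text \<open>
  An operator that commutes with \<open>F\<close> and moves a minimal \<open>F\<close>-stable subspace \<open>U\<close> out of itself
  embeds \<open>U\<close> into \<open>V / U\<close>.
\<close>

lemma irreducible_subspace_half_dim:
  assumes fin: "finite_dim scale V" and irr: "irreducible (F \<union> G) V" and nirr: "\<not> irreducible F V"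
    and lin: "\<And>f. f \<in> F \<union> G \<Longrightarrow> linear_on V f"
    and comm: "\<And>f g v. f \<in> F \<Longrightarrow> g \<in> G \<Longrightarrow> v \<in> V \<Longrightarrow> f (g v) = g (f v)"
  obtains U where "stable F U" "U \<subseteq> V" "U \<noteq> {0}" "2 * dim U \<le> dim V"
proof -
  have V: "stable (F \<union> G) V" "V \<noteq> {0}" "subspace V"
    and V_min: "\<And>U. stable (F \<union> G) U \<Longrightarrow> U \<subseteq> V \<Longrightarrow> U = {0} \<or> U = V"
    using irr by (auto simp: irreducible_def stable_def)
  obtain U where U: "U \<subseteq> V" "irreducible F U"
    using ex_irreducible[of F V] V fin stable_mono by blast
  have sU: "stable F U" "U \<noteq> {0}" "subspace U" using U by (auto simp: irreducible_def stable_def)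
  have "U \<noteq> V" using U nirr by blast
  then have "\<not> stable (F \<union> G) U" using V_min U sU by blast
  then obtain g u where g: "g \<in> G" "u \<in> U" "g u \<notin> U"
    using sU by (auto simp: stable_def)
  have lg: "linear_on V g" using lin g by blast
  \<comment> \<open>\<open>K\<close> is the kernel of the map that \<open>g\<close> induces from
    \<open>U\<close> to \<open>V / U\<close>. It is \<open>F\<close>-stable since \<open>g\<close>
    commutes with \<open>F\<close>, and it misses \<open>u\<close>, so minimality of
    \<open>U\<close> forces \<open>K = {0}\<close>.\<close>
  define K where "K = {u \<in> U. g u \<in> U}"
  have "stable F K"
    unfolding stable_def
  proof (intro conjI ballI)
    have "g 0 = 0" using lg V(3) by (rule linear_on_0)
    then show "subspace K"
      unfolding K_def using sU(3) U(1)
      by (intro subspaceI) (auto simp: subspace_0 subspace_add subspace_scale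
          linear_on_add[OF lg] linear_on_scale[OF lg] subset_iff)
    fix f x assume fx: "f \<in> F" "x \<in> K"
    then have "x \<in> V" using U(1) by (auto simp: K_def)
    then have "g (f x) = f (g x)" using comm[OF fx(1) g(1)] by simp
    with fx sU(1) show "f x \<in> K" by (auto simp: K_def stable_def)
  qed
  moreover have "K \<subseteq> U" "K \<noteq> U" using g by (auto simp: K_def)
  ultimately have K: "K = {0}" using U(2) by (auto simp: irreducible_def)
  obtain C p where p: "Vector_Spaces.linear scale scale p" "subspace C" "C \<subseteq> V" "p ` V \<subseteq> C"
    "\<forall>w\<in>U. p w = 0" "\<forall>v\<in>C. p v = v" "\<forall>v\<in>V. v - p v \<in> U" "dim V = dim U + dim C"
    by (rule complement_projection[OF V(3) fin sU(3) U(1)])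
  interpret p: Vector_Spaces.linear scale scale p by (rule p(1))
  have gV: "g v \<in> V" if "v \<in> V" for v
    using that V(1) g by (auto simp: stable_def)
  have "dim U \<le> dim C"
  proof (rule dim_le_of_inj)
    show "linear_on U (\<lambda>u. p (g u))"
      unfolding linear_on_def using U(1)
      by (auto simp: linear_on_add[OF lg] linear_on_scale[OF lg] p.add p.scale subset_iff)
    show "(\<lambda>u. p (g u)) ` U \<subseteq> C" using p(4) gV U(1) by blast
    show "u = 0" if "u \<in> U" "p (g u) = 0" for u
    proof -
      have "g u \<in> U" using p(7) gV[of u] that U(1) by force
      then show ?thesis using K that(1) by (auto simp: K_def)
    qed
  qed (use sU p finite_dim_subset[OF fin] in auto)
  then show thesis using that sU U(1) p(8) by simp
qed

section \<open>Eigenvectors of complex operators and Schur's lemma\<close>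

lemma linear_relation:
  assumes "finite C" "card C \<le> n" "\<And>i. i \<le> n \<Longrightarrow> x i \<in> span C"
  obtains u where "(\<Sum>i\<le>n. u i *s x i) = 0" "\<exists>i\<le>n. u i \<noteq> 0"
proof (cases "inj_on x {..n}")
  case True
  have "\<not> independent (x ` {..n})"
  proof
    assume "independent (x ` {..n})"
    moreover have "x ` {..n} \<subseteq> span C" using assms by auto
    ultimately have "card (x ` {..n}) \<le> card C"
      using independent_span_bound[OF assms(1)] by blast
    then show False using True assms(2) by (simp add: card_image)
  qed
  then obtain u v where "(\<Sum>v\<in>x ` {..n}. u v *s v) = 0" "v \<in> x ` {..n}" "u v \<noteq> 0"
    unfolding dependent_finite[OF finite_imageI[OF finite_atMost]] by blast
  then show thesis
    using True by (intro that[of "u \<circ> x"]) (auto simp: sum.reindex)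
next
  case False
  \<comment> \<open>If two vectors coincide, the set of all of them may still be independent, so the
    relation \<open>x i - x j = 0\<close> is written down directly.\<close>
  then obtain i j where ij: "i \<le> n" "j \<le> n" "i \<noteq> j" "x i = x j" by (auto simp: inj_on_def)
  define u :: "nat \<Rightarrow> complex" where "u k = (if k = i then 1 else if k = j then - 1 else 0)" for k
  have "(\<Sum>k\<le>n. u k *s x k) = (\<Sum>k\<in>{i, j}. u k *s x k)"
    using ij by (intro sum.mono_neutral_right) (auto simp: u_def)
  also have "\<dots> = 0" using ij by (simp add: u_def)
  finally show thesis using ij(1) by (intro that[of u]) (auto simp: u_def)
qed

text \<open>Split off a root, \<open>p = (X - r) q\<close>, and let \<open>w = q(f) v\<close>. If
  \<open>w = 0\<close>, then \<open>q\<close> annihilates \<open>v\<close> and has smaller degree;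
  otherwise \<open>(f - r) w = p(f) v = 0\<close> makes \<open>w\<close> an eigenvector for
  \<open>r\<close>.\<close>

lemma eigenvector_of_annihilating_poly:
  assumes V: "subspace V" and f: "linear_on V f" "f ` V \<subseteq> V"
    and v: "v \<in> V" "v \<noteq> 0"
    and p: "p \<noteq> 0" "degree p \<le> n" "(\<Sum>i\<le>n. coeff p i *s (f ^^ i) v) = 0"
  shows "\<exists>c. \<exists>w\<in>V. w \<noteq> 0 \<and> f w = c *s w"
  using p
proof (induction n arbitrary: p)
  case 0
  then show ?case using v by (auto elim!: degree_eq_zeroE)
next
  case (Suc n)
  have fV: "(f ^^ i) v \<in> V" for i
    by (induction i) (use v f in auto)
  show ?case
  proof (cases "degree p = 0")
    case True
    \<comment> \<open>A nonzero constant cannot annihilate \<open>v\<close>, so this case is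
      contradictory.\<close>
    then obtain a where a: "p = [:a:]" by (auto elim: degree_eq_zeroE)
    have "(\<Sum>i\<le>Suc n. coeff p i *s (f ^^ i) v) = a *s v"
      unfolding a sum.atMost_Suc_shift by simp
    then show ?thesis using Suc.prems a v by auto
  next
    case False
    then have "\<not> constant (poly p)" by (simp add: constant_degree)
    then obtain r where "poly p r = 0" using fundamental_theorem_of_algebra by blast
    then obtain q where q: "p = [:- r, 1:] * q" using poly_eq_0_iff_dvd by (metis dvdE)
    have "q \<noteq> 0" using q Suc.prems by auto
    then have dq: "degree q \<le> n" using Suc.prems(2) unfolding q by (subst (asm) degree_mult_eq) auto
    define w where "w = (\<Sum>i\<le>n. coeff q i *s (f ^^ i) v)"
    have wV: "w \<in> V" unfolding w_def by (intro subspace_sum subspace_scale V fV)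
    show ?thesis
    proof (cases "w = 0")
      case True
      then show ?thesis using Suc.IH \<open>q \<noteq> 0\<close> dq by (simp add: w_def)
    next
      case False
      \<comment> \<open>The linear extension \<open>g\<close> of \<open>f\<close> can be pulled out
        of the sum defining \<open>w\<close>.\<close>
      obtain g where g: "Vector_Spaces.linear scale scale g" "\<forall>v\<in>V. g v = f v"
        using linear_on_extend[OF f(1) V] by blast
      interpret g: Vector_Spaces.linear scale scale g by (rule g(1))
      \<comment> \<open>Multiplication by \<open>X\<close> shifts coefficients, which amounts to
        applying \<open>f\<close> once more; the annihilating sum for \<open>p\<close> becomes
        \<open>f w - r w\<close>.\<close>
      have "p = pCons 0 q - smult r q" by (simp add: q algebra_simps)
      then have "(\<Sum>i\<le>Suc n. coeff p i *s (f ^^ i) v) =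
          (\<Sum>i\<le>Suc n. coeff (pCons 0 q) i *s (f ^^ i) v) - r *s (\<Sum>i\<le>Suc n. coeff q i *s (f ^^ i) v)"
        by (simp only: coeff_diff coeff_smult scale_left_diff_distrib sum_subtractf scale_sum_right
            scale_scale)
      also have "(\<Sum>i\<le>Suc n. coeff (pCons 0 q) i *s (f ^^ i) v) = (\<Sum>i\<le>n. coeff q i *s g ((f ^^ i) v))"
        unfolding sum.atMost_Suc_shift using g(2) fV by simp
      also have "\<dots> = g w" by (simp add: w_def g.sum g.scale)
      also have "\<dots> = f w" using g(2) wV by blast
      also have "(\<Sum>i\<le>Suc n. coeff q i *s (f ^^ i) v) = w"
        using dq by (simp add: w_def coeff_eq_0)
      finally show ?thesis using Suc.prems(3) False wV by (metis eq_iff_diff_eq_0)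
    qed
  qed
qed

text \<open>The iterates of a nonzero \<open>v\<close> up to exponent \<open>card C\<close> are one
  more than the spanning vectors, hence linearly related; the relation is read as an annihilating
  polynomial.\<close>

lemma ex_eigenvector:
  assumes V: "subspace V" "finite_dim scale V" "V \<noteq> {0}" and f: "linear_on V f" "f ` V \<subseteq> V"
  obtains c w where "w \<in> V" "w \<noteq> 0" "f w = c *s w"
proof -
  obtain v where v: "v \<in> V" "v \<noteq> 0" using V subspace_0 by blast
  have fV: "(f ^^ i) v \<in> V" for i
    by (induction i) (use v f in auto)
  obtain C where C: "finite C" "V \<subseteq> span C" using V(2) unfolding finite_dim_def by blast
  let ?n = "card C"
  obtain u where u: "(\<Sum>i\<le>?n. u i *s (f ^^ i) v) = 0" "\<exists>i\<le>?n. u i \<noteq> 0"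
    by (rule linear_relation[OF C(1) order_refl, of "\<lambda>i. (f ^^ i) v"]) (use fV C(2) in auto)
  define p where "p = (\<Sum>i\<le>?n. monom (u i) i)"
  have cp: "coeff p k = (if k \<le> ?n then u k else 0)" for k
    by (simp add: p_def coeff_sum)
  have "p \<noteq> 0" using u(2) cp by (metis coeff_0)
  moreover have "degree p \<le> ?n" by (intro degree_le) (simp add: cp)
  moreover have "(\<Sum>i\<le>?n. coeff p i *s (f ^^ i) v) = 0" using u(1) by (simp add: cp)
  ultimately show thesis
    using eigenvector_of_annihilating_poly[OF V(1) f v] that by blast
qed

text \<open>Schur's lemma.\<close>

lemma irreducible_commuting_scalar:
  assumes irr: "irreducible F V" and fin: "finite_dim scale V"
    and F: "\<And>f. f \<in> F \<Longrightarrow> linear_on V f"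
    and g: "linear_on V g" "g ` V \<subseteq> V" "\<And>f v. f \<in> F \<Longrightarrow> v \<in> V \<Longrightarrow> f (g v) = g (f v)"
  obtains c where "\<And>v. v \<in> V \<Longrightarrow> g v = c *s v"
proof -
  have V: "stable F V" "V \<noteq> {0}" "subspace V"
    and V_min: "\<And>U. stable F U \<Longrightarrow> U \<subseteq> V \<Longrightarrow> U = {0} \<or> U = V"
    using irr by (auto simp: irreducible_def stable_def)
  obtain c w where w: "w \<in> V" "w \<noteq> 0" "g w = c *s w"
    using ex_eigenvector[OF V(3) fin V(2) g(1,2)] .
  \<comment> \<open>The eigenspace for \<open>c\<close> is \<open>F\<close>-stable by commutation
    and contains \<open>w\<close>, so irreducibility makes it all of \<open>V\<close>.\<close>
  define E where "E = {v \<in> V. g v = c *s v}"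
  have "stable F E"
    unfolding stable_def
  proof (intro conjI ballI)
    have "g 0 = 0" using g(1) V(3) by (rule linear_on_0)
    then show "subspace E"
      unfolding E_def using V(3)
      by (intro subspaceI) (auto simp: subspace_0 subspace_add subspace_scale
          linear_on_add[OF g(1)] linear_on_scale[OF g(1)] scale_right_distrib mult.commute)
    fix f v assume fv: "f \<in> F" "v \<in> E"
    then have "g (f v) = f (c *s v)" using g(3) by (auto simp: E_def)
    also have "\<dots> = c *s f v" using linear_on_scale[OF F] fv by (auto simp: E_def)
    finally show "f v \<in> E" using fv V(1) by (auto simp: E_def stable_def)
  qed
  then have "E = V" using V_min[of E] w by (auto simp: E_def)
  then show thesis using that by (auto simp: E_def)
qed

end

section \<open>Representations of simple Lie algebras\<close>

context lie_algebra
begin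

lemma bracket_zero_left [simp]: "x \<in> L \<Longrightarrow> bracket 0 x = 0"
  using bracket_scale_left[of x x 0] by simp

lemma bracket_zero_right [simp]: "x \<in> L \<Longrightarrow> bracket x 0 = 0"
  using bracket_scale_right[of x x 0] by simp

lemma bracket_anticommute:
  assumes "x \<in> L" "y \<in> L"
  shows "bracket x y = - bracket y x"
proof -
  have xy: "x + y \<in> L" using assms subspace_add[OF subspace_carrier] by blast
  have "0 = bracket (x + y) (x + y)" using xy bracket_self by simp
  also have "\<dots> = bracket x (x + y) + bracket y (x + y)"
    using assms xy by (intro bracket_add_left)
  also have "\<dots> = bracket x y + bracket y x"
    using assms by (simp add: bracket_add_right bracket_self)
  finally show ?thesis by (metis eq_neg_iff_add_eq_0)
qed

text \<open>\<open>lie_ideal\<close> demands absorption on one side only; anticommutativity supplies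
  the other.\<close>

lemma lie_idealD:
  assumes "lie_ideal J"
  shows "subspace J" "J \<subseteq> L" "x \<in> L \<Longrightarrow> y \<in> J \<Longrightarrow> bracket x y \<in> J"
    "x \<in> J \<Longrightarrow> y \<in> L \<Longrightarrow> bracket x y \<in> J"
proof -
  show J: "subspace J" "J \<subseteq> L" "x \<in> L \<Longrightarrow> y \<in> J \<Longrightarrow> bracket x y \<in> J" for x y
    using assms by (auto simp: lie_ideal_def)
  show "bracket x y \<in> J" if "x \<in> J" "y \<in> L"
  proof -
    have "bracket x y = - bracket y x" using that J(2) by (intro bracket_anticommute) auto
    then show ?thesis using subspace_neg[OF J(1) J(3)] that by simp
  qed
qed

lemma lie_ideal_lie_algebra:
  assumes "lie_ideal J"
  shows "lie_algebra scale J bracket"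
proof -
  have mem: "x \<in> L" if "x \<in> J" for x using that lie_idealD(2)[OF assms] by blast
  show ?thesis
    by unfold_locales
      (auto simp: lie_idealD(1)[OF assms] lie_idealD(3)[OF assms] mem bracket_add_left
        bracket_add_right bracket_scale_left bracket_scale_right bracket_self jacobi)
qed

text \<open>The derived algebra is an ideal, and it is nonzero because \<open>simple\<close>
  excludes abelian algebras. Thus simple algebras are perfect.\<close>

lemma simple_span_brackets:
  assumes simple
  shows "span {bracket x y | x y. x \<in> L \<and> y \<in> L} = L" (is "span ?B = L")
proof -
  have sub: "span ?B \<subseteq> L"
    by (rule span_minimal) (auto simp: bracket_closed subspace_carrier)
  then have "lie_ideal (span ?B)"
    unfolding lie_ideal_def by (auto intro!: span_base)
  moreover obtain x y where "x \<in> L" "y \<in> L" "bracket x y \<noteq> 0"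
    using assms unfolding simple_def abelian_def by blast
  then have "span ?B \<noteq> {0}" using span_base[of "bracket x y" ?B] by blast
  ultimately show ?thesis using assms unfolding simple_def by blast
qed

end

section \<open>Kernels, submodules and quotients\<close>

context lie_representation
begin

lemma rep_zero: "v \<in> V \<Longrightarrow> \<rho> 0 v = 0"
  using rep_scale[of 0 v 0] subspace_0[OF subspace_carrier] by simp

text \<open>By perfectness the brackets span \<open>L\<close>, and \<open>\<rho> x v\<close> is
  linear in \<open>x\<close>.\<close>

lemma trivial_if_trivial_on_brackets:
  assumes simple and "\<And>x y v. x \<in> L \<Longrightarrow> y \<in> L \<Longrightarrow> v \<in> V \<Longrightarrow> \<rho> (bracket x y) v = 0"
    and "x \<in> L" "v \<in> V"
  shows "\<rho> x v = 0"
proof -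
  have "x \<in> L \<and> \<rho> x v = 0" if "x \<in> span {bracket x y | x y. x \<in> L \<and> y \<in> L}" for x
    using that
  proof (induction rule: span_induct_alt)
    case base
    then show ?case using rep_zero assms subspace_0[OF subspace_carrier] by simp
  next
    case (step c b y)
    then have "b \<in> L" "\<rho> b v = 0" using assms by (auto simp: bracket_closed)
    with step show ?case
      using assms by (simp add: rep_add rep_scale subspace_add[OF subspace_carrier]
          subspace_scale[OF subspace_carrier])
  qed
  then show ?thesis using assms simple_span_brackets by blast
qed

text \<open>The elements acting as zero form an ideal, which is not \<open>L\<close> because of
  \<open>x0\<close>, so simplicity makes it zero.\<close>

lemma simple_faithful:
  assumes simple and x0: "x0 \<in> L" "v0 \<in> V" "\<rho> x0 v0 \<noteq> 0"
  shows "faithful_lie_representation scale L bracket scaleV V \<rho>"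
proof -
  define K where "K = {x \<in> L. \<forall>v\<in>V. \<rho> x v = 0}"
  have "lie_ideal K"
    unfolding lie_ideal_def
  proof (intro conjI ballI)
    show "subspace K"
      using subspace_carrier
      by (intro subspaceI) (auto simp: K_def rep_zero rep_add rep_scale subspace_0 subspace_add
          subspace_scale)
    show "K \<subseteq> L" by (auto simp: K_def)
    fix x y assume "x \<in> L" "y \<in> K"
    moreover from this have "\<rho> x 0 = 0"
      using rep_scale_vec[of x 0 0] rep.subspace_0[OF subspace_rep] by simp
    ultimately show "bracket x y \<in> K"
      by (auto simp: K_def bracket_closed rep_bracket rep_closed)
  qed
  moreover have "K \<noteq> L" using x0 by (auto simp: K_def)
  ultimately have K: "K = {0}" using assms(1) unfolding simple_def by blast
  show ?thesis
  proof unfold_locales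
    show "inj_on (\<lambda>x. restrict (\<rho> x) V) L"
    proof (rule inj_onI)
      fix x y assume xy: "x \<in> L" "y \<in> L" "restrict (\<rho> x) V = restrict (\<rho> y) V"
      have "x - y \<in> L" using xy subspace_diff[OF subspace_carrier] by blast
      moreover have "\<rho> (x - y) v = 0" if v: "v \<in> V" for v
      proof -
        have "\<rho> x v = \<rho> y v" using fun_cong[OF xy(3), of v] v by simp
        moreover have "\<rho> ((x - y) + y) v = \<rho> (x - y) v + \<rho> y v"
          using \<open>x - y \<in> L\<close> xy(2) v by (rule rep_add)
        ultimately show ?thesis by simp
      qed
      ultimately have "x - y \<in> K" by (simp add: K_def)
      then show "x = y" using K by simp
    qed
  qed
qed

lemma subrepresentation:
  assumes "rep.subspace U" "U \<subseteq> V" "\<And>x u. x \<in> L \<Longrightarrow> u \<in> U \<Longrightarrow> \<rho> x u \<in> U"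
  shows "lie_representation scale L bracket scaleV U \<rho>"
proof -
  have mem: "u \<in> V" if "u \<in> U" for u using that assms by blast
  show ?thesis
    by unfold_locales
      (auto simp: assms mem rep_add_vec rep_scale_vec rep_add rep_scale rep_bracket)
qed

text \<open>This is the action induced on \<open>V / W\<close>, transported to the complement
  \<open>C\<close>.\<close>

lemma quotient_representation:
  assumes p: "Vector_Spaces.linear scaleV scaleV p" and C: "rep.subspace C" "C \<subseteq> V" "p ` V \<subseteq> C"
    and W: "W \<subseteq> V" "\<And>x w. x \<in> L \<Longrightarrow> w \<in> W \<Longrightarrow> \<rho> x w \<in> W"
    and pW: "\<forall>w\<in>W. p w = 0" and pV: "\<forall>v\<in>V. v - p v \<in> W"
  shows "lie_representation scale L bracket scaleV C (\<lambda>x v. p (\<rho> x v))"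
proof -
  interpret p: Vector_Spaces.linear scaleV scaleV p by (rule p)
  have mem: "v \<in> V" if "v \<in> C" for v using that C by blast
  \<comment> \<open>The vectors \<open>v\<close> and \<open>p v\<close> differ by an element of
    \<open>W\<close>, which stays in \<open>W\<close> under \<open>\<rho> x\<close> and is then
    killed by \<open>p\<close>. The bracket identity rests on this.\<close>
  have p\<rho>: "p (\<rho> x (p v)) = p (\<rho> x v)" if "x \<in> L" "v \<in> V" for x v
  proof -
    have *: "v - p v \<in> W" "p v \<in> V" using that pV C by auto
    have "\<rho> x v = \<rho> x ((v - p v) + p v)" by simp
    also have "\<dots> = \<rho> x (v - p v) + \<rho> x (p v)"
      using that * W(1) by (intro rep_add_vec) auto
    finally have "p (\<rho> x v) = p (\<rho> x (v - p v)) + p (\<rho> x (p v))" by (simp add: p.add)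
    moreover have "p (\<rho> x (v - p v)) = 0" using pW W(2) * that by blast
    ultimately show ?thesis by simp
  qed
  show ?thesis
  proof unfold_locales
    show "rep.subspace C" by (rule C)
    show "p (\<rho> x v) \<in> C" if "x \<in> L" "v \<in> C" for x v
      using that C mem rep_closed by blast
    show "p (\<rho> (bracket x y) v) = p (\<rho> x (p (\<rho> y v))) - p (\<rho> y (p (\<rho> x v)))"
      if "x \<in> L" "y \<in> L" "v \<in> C" for x y v
      using that by (simp add: p\<rho> rep_closed mem rep_bracket p.diff)
  qed (simp_all add: mem rep_add_vec rep_scale_vec rep_add rep_scale p.add p.scale)
qed

end

section \<open>Commuting representations of simple Lie algebras\<close>

text \<open>
  A single \<open>\<rho>\<close> carries the representations of all \<open>s i\<close>; only its values on the \<open>s i\<close> matter.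
\<close>

locale simple_lie_family = complex_vector_space scaleV
  for scaleV :: "complex \<Rightarrow> 'v::ab_group_add \<Rightarrow> 'v" +
  fixes scale :: "complex \<Rightarrow> 'a::ab_group_add \<Rightarrow> 'a"
    and bracket :: "'a \<Rightarrow> 'a \<Rightarrow> 'a"
    and s :: "'i \<Rightarrow> 'a set"
begin

text \<open>For simple \<open>s i\<close> this already yields faithfulness by
  \<open>simple_faithful\<close>, and it is easier to pass on to submodules and quotients.\<close>

definition acts_nontrivially :: "'i \<Rightarrow> 'v set \<Rightarrow> ('a \<Rightarrow> 'v \<Rightarrow> 'v) \<Rightarrow> bool"
  where "acts_nontrivially i V \<rho> \<longleftrightarrow> (\<exists>x\<in>s i. \<exists>v\<in>V. \<rho> x v \<noteq> 0)"

text \<open>All three arguments vary in the induction: \<open>S\<close> and \<open>V\<close> shrink,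
  and on the model of a quotient \<open>\<rho>\<close> is replaced by its composition with a
  projection.\<close>

definition commuting_family :: "'i set \<Rightarrow> 'v set \<Rightarrow> ('a \<Rightarrow> 'v \<Rightarrow> 'v) \<Rightarrow> bool"
  where "commuting_family S V \<rho> \<longleftrightarrow>
    subspace V \<and> finite_dim scaleV V \<and> finite S \<and>
    (\<forall>i\<in>S. lie_algebra.simple scale (s i) bracket \<and>
      lie_representation scale (s i) bracket scaleV V \<rho> \<and> acts_nontrivially i V \<rho>) \<and>
    (\<forall>i\<in>S. \<forall>j\<in>S. i \<noteq> j \<longrightarrow>
      (\<forall>x\<in>s i. \<forall>y\<in>s j. \<forall>v\<in>V. \<rho> x (\<rho> y v) = \<rho> y (\<rho> x v)))"

abbreviation operators :: "('a \<Rightarrow> 'v \<Rightarrow> 'v) \<Rightarrow> 'i set \<Rightarrow> ('v \<Rightarrow> 'v) set"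
  where "operators \<rho> S \<equiv> \<rho> ` (\<Union>i\<in>S. s i)"

lemma commuting_familyD:
  assumes "commuting_family S V \<rho>"
  shows "subspace V" "finite_dim scaleV V" "finite S"
    "i \<in> S \<Longrightarrow> lie_algebra.simple scale (s i) bracket"
    "i \<in> S \<Longrightarrow> lie_representation scale (s i) bracket scaleV V \<rho>"
    "i \<in> S \<Longrightarrow> acts_nontrivially i V \<rho>"
    "i \<in> S \<Longrightarrow> j \<in> S \<Longrightarrow> i \<noteq> j \<Longrightarrow> x \<in> s i \<Longrightarrow> y \<in> s j \<Longrightarrow> v \<in> V \<Longrightarrow>
      \<rho> x (\<rho> y v) = \<rho> y (\<rho> x v)"
  using assms by (simp_all add: commuting_family_def)

lemma commuting_family_stable:
  assumes "commuting_family S V \<rho>"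
  shows "stable (operators \<rho> S) V"
  unfolding stable_def
proof (intro conjI ballI)
  show "subspace V" using assms by (rule commuting_familyD)
  fix f v assume "f \<in> operators \<rho> S" "v \<in> V"
  then obtain i x where i: "i \<in> S" "x \<in> s i" "f = \<rho> x" by blast
  interpret R: lie_representation scale "s i" bracket scaleV V \<rho>
    using commuting_familyD(5)[OF assms i(1)] .
  show "f v \<in> V" using i \<open>v \<in> V\<close> R.rep_closed by simp
qed

lemma commuting_family_linear_on:
  assumes "commuting_family S V \<rho>" "f \<in> operators \<rho> S"
  shows "linear_on V f"
proof -
  obtain i x where i: "i \<in> S" "x \<in> s i" "f = \<rho> x" using assms(2) by blast
  interpret R: lie_representation scale "s i" bracket scaleV V \<rho>
    using commuting_familyD(5)[OF assms(1) i(1)] .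
  show ?thesis using i by (simp add: linear_on_def R.rep_add_vec R.rep_scale_vec)
qed

text \<open>\<open>U\<close> has to be stable only under the algebras that are kept; this admits
  subspaces that are minimal for one part of the family.\<close>

lemma commuting_family_restrict:
  assumes fam: "commuting_family S V \<rho>" and S': "S' \<subseteq> S"
    and U: "stable (operators \<rho> S') U" "U \<subseteq> V" "\<And>i. i \<in> S' \<Longrightarrow> acts_nontrivially i U \<rho>"
  shows "commuting_family S' U \<rho>"
  unfolding commuting_family_def
proof (intro conjI ballI impI)
  show "subspace U" using U(1) by (rule stable_subspace)
  show "finite_dim scaleV U" using finite_dim_subset[OF commuting_familyD(2)[OF fam] U(2)] .
  show "finite S'" using finite_subset[OF S' commuting_familyD(3)[OF fam]] .
  fix i assume i: "i \<in> S'"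
  show "lie_algebra.simple scale (s i) bracket" using commuting_familyD(4)[OF fam] i S' by blast
  show "acts_nontrivially i U \<rho>" using U(3) i .
  have "i \<in> S" using i S' by blast
  then interpret R: lie_representation scale "s i" bracket scaleV V \<rho>
    by (rule commuting_familyD(5)[OF fam])
  show "lie_representation scale (s i) bracket scaleV U \<rho>"
    using U(1) i by (intro R.subrepresentation U(2)) (auto simp: stable_def)
  fix j x y v assume "j \<in> S'" "i \<noteq> j" "x \<in> s i" "y \<in> s j" "v \<in> U"
  then show "\<rho> x (\<rho> y v) = \<rho> y (\<rho> x v)"
    using i S' U(2) by (intro commuting_familyD(7)[OF fam, of i j]) auto
qed

text \<open>If all operators of \<open>s i\<close> commuted, brackets would act as zero, and so
  would all of the perfect algebra \<open>s i\<close>. This rules out actions by scalars and actions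
  trivial on both a submodule and its quotient.\<close>

lemma acts_nontrivially_if_brackets:
  assumes fam: "commuting_family S V \<rho>" and i: "i \<in> S"
  shows "\<exists>x\<in>s i. \<exists>y\<in>s i. \<exists>v\<in>V. \<rho> x (\<rho> y v) \<noteq> \<rho> y (\<rho> x v)"
proof (rule ccontr)
  assume "\<not> ?thesis"
  then have eq: "\<rho> x (\<rho> y v) = \<rho> y (\<rho> x v)" if "x \<in> s i" "y \<in> s i" "v \<in> V" for x y v
    using that by blast
  interpret R: lie_representation scale "s i" bracket scaleV V \<rho>
    using commuting_familyD(5)[OF fam i] .
  have "\<rho> (bracket x y) v = 0" if "x \<in> s i" "y \<in> s i" "v \<in> V" for x y v
    using R.rep_bracket[OF that] eq[OF that] by simp
  then have "\<rho> x v = 0" if "x \<in> s i" "v \<in> V" for x v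
    by (rule R.trivial_if_trivial_on_brackets[OF commuting_familyD(4)[OF fam i] _ that])
  then show False using commuting_familyD(6)[OF fam i] by (auto simp: acts_nontrivially_def)
qed

text \<open>The vectors killed by \<open>s i\<close> form a subspace stable under the whole family,
  since the other algebras commute with \<open>s i\<close>. It is not \<open>V\<close>, so
  irreducibility makes it zero.\<close>

lemma acts_nontrivially_on_subspace:
  assumes fam: "commuting_family S V \<rho>" and irr: "irreducible (operators \<rho> S) V"
    and i: "i \<in> S" and U: "U \<subseteq> V" "subspace U" "U \<noteq> {0}"
  shows "acts_nontrivially i U \<rho>"
proof -
  interpret R: lie_representation scale "s i" bracket scaleV V \<rho>
    using commuting_familyD(5)[OF fam i] .
  have V: "subspace V" using fam by (rule commuting_familyD)
  have z: "\<rho> x 0 = 0" if "j \<in> S" "x \<in> s j" for j x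
    using that by (intro linear_on_0[OF commuting_family_linear_on[OF fam] V]) auto
  define N where "N = {v \<in> V. \<forall>x\<in>s i. \<rho> x v = 0}"
  have "stable (operators \<rho> S) N"
    unfolding stable_def
  proof (intro conjI ballI)
    show "subspace N"
      using V z[OF i] by (intro subspaceI)
        (auto simp: N_def subspace_0 subspace_add subspace_scale R.rep_add_vec R.rep_scale_vec)
    fix f v assume f: "f \<in> operators \<rho> S" and v: "v \<in> N"
    then obtain j y where j: "j \<in> S" "y \<in> s j" "f = \<rho> y" by blast
    have vV: "v \<in> V" using v by (simp add: N_def)
    have "\<rho> x (\<rho> y v) = 0" if x: "x \<in> s i" for x
    proof (cases "i = j")
      case True
      then show ?thesis using v j z[OF i x] by (simp add: N_def)
    next
      case False
      then have "\<rho> x (\<rho> y v) = \<rho> y (\<rho> x v)"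
        using commuting_familyD(7)[OF fam i j(1) False x j(2) vV] by simp
      then show ?thesis using v x z[OF j(1,2)] by (simp add: N_def)
    qed
    moreover have "\<rho> y v \<in> V"
      using commuting_family_stable[OF fam] f j vV by (auto simp: stable_def)
    ultimately show "f v \<in> N" using j by (simp add: N_def)
  qed
  moreover have "N \<subseteq> V" "N \<noteq> V"
    using commuting_familyD(6)[OF fam i] by (auto simp: N_def acts_nontrivially_def)
  ultimately have N: "N = {0}" using irr by (auto simp: irreducible_def)
  obtain u where "u \<in> U" "u \<noteq> 0" using U subspace_0 by blast
  then show ?thesis using N U by (auto simp: N_def acts_nontrivially_def)
qed

text \<open>Otherwise Schur's lemma would make each \<open>s j\<close> with \<open>j\<close> in
  \<open>S2\<close> act by scalars. Scalars commute, contrary to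
  \<open>acts_nontrivially_if_brackets\<close>.\<close>

lemma not_irreducible_part:
  assumes fam: "commuting_family (S1 \<union> S2) V \<rho>" and disj: "S1 \<inter> S2 = {}" "S2 \<noteq> {}"
  shows "\<not> irreducible (operators \<rho> S1) V"
proof
  assume irr: "irreducible (operators \<rho> S1) V"
  obtain j where j: "j \<in> S2" using disj by blast
  have "\<exists>c. \<forall>v\<in>V. \<rho> y v = scaleV c v" if y: "y \<in> s j" for y
  proof -
    have op: "\<rho> y \<in> operators \<rho> (S1 \<union> S2)" using y j by blast
    have "linear_on V f" if "f \<in> operators \<rho> S1" for f
      using that by (intro commuting_family_linear_on[OF fam]) auto
    moreover have "\<rho> y ` V \<subseteq> V"
      using commuting_family_stable[OF fam] op unfolding stable_def by blast
    moreover have "f (\<rho> y v) = \<rho> y (f v)" if "f \<in> operators \<rho> S1" "v \<in> V" for f v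
    proof -
      obtain i x where i: "i \<in> S1" "x \<in> s i" "f = \<rho> x" using \<open>f \<in> operators \<rho> S1\<close> by blast
      moreover have "i \<noteq> j" using i j disj by blast
      ultimately show ?thesis
        using commuting_familyD(7)[OF fam, of i j x y v] j y \<open>v \<in> V\<close> by simp
    qed
    ultimately obtain c where "\<And>v. v \<in> V \<Longrightarrow> \<rho> y v = scaleV c v"
      using irreducible_commuting_scalar[OF irr commuting_familyD(2)[OF fam] _
          commuting_family_linear_on[OF fam op]] by metis
    then show ?thesis by blast
  qed
  moreover obtain x y v where xyv: "x \<in> s j" "y \<in> s j" "v \<in> V" "\<rho> x (\<rho> y v) \<noteq> \<rho> y (\<rho> x v)"
    using acts_nontrivially_if_brackets[OF fam, of j] j by blast
  ultimately obtain c d where cd: "\<forall>v\<in>V. \<rho> x v = scaleV c v" "\<forall>v\<in>V. \<rho> y v = scaleV d v"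
    by blast
  have "subspace V" using fam by (rule commuting_familyD)
  then show False
    using xyv cd by (simp add: subspace_scale mult.commute)
qed

text \<open>The small subspace comes from reducibility under \<open>S1\<close>, while nontriviality
  of the action on it comes from irreducibility under \<open>S1 \<union> S2\<close>.\<close>

lemma commuting_subfamily_half_dim:
  assumes fam: "commuting_family (S1 \<union> S2) V \<rho>" and disj: "S1 \<inter> S2 = {}" "S2 \<noteq> {}"
    and irr: "irreducible (operators \<rho> (S1 \<union> S2)) V"
  obtains U where "commuting_family S1 U \<rho>" "2 * dim U \<le> dim V"
proof -
  have op: "operators \<rho> (S1 \<union> S2) = operators \<rho> S1 \<union> operators \<rho> S2" by blast
  obtain U where U: "stable (operators \<rho> S1) U" "U \<subseteq> V" "U \<noteq> {0}" "2 * dim U \<le> dim V"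
  proof (rule irreducible_subspace_half_dim)
    show "finite_dim scaleV V" using fam by (rule commuting_familyD)
    show "irreducible (operators \<rho> S1 \<union> operators \<rho> S2) V" using irr unfolding op .
    show "\<not> irreducible (operators \<rho> S1) V" using fam disj by (rule not_irreducible_part)
    show "linear_on V f" if "f \<in> operators \<rho> S1 \<union> operators \<rho> S2" for f
      using commuting_family_linear_on[OF fam] that unfolding op by blast
    show "f (g v) = g (f v)" if "f \<in> operators \<rho> S1" "g \<in> operators \<rho> S2" "v \<in> V" for f g v
    proof -
      obtain i x where i: "i \<in> S1" "x \<in> s i" "f = \<rho> x" using \<open>f \<in> operators \<rho> S1\<close> by blast
      obtain j y where j: "j \<in> S2" "y \<in> s j" "g = \<rho> y" using \<open>g \<in> operators \<rho> S2\<close> by blast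
      have "i \<noteq> j" using i j disj by blast
      then show ?thesis
        using commuting_familyD(7)[OF fam, of i j x y v] i j \<open>v \<in> V\<close> by simp
    qed
  qed
  have "commuting_family S1 U \<rho>"
    using fam _ U(1,2)
  proof (rule commuting_family_restrict)
    show "acts_nontrivially i U \<rho>" if "i \<in> S1" for i
      using that U stable_subspace by (intro acts_nontrivially_on_subspace[OF fam irr]) auto
  qed simp
  then show thesis using that U(4) by blast
qed

text \<open>The bound concerns separate commuting algebras instead of modules for their direct sum,
  because the subspaces found for one part need not be stable under the other.\<close>

theorem sum_lie_mu_le_dim:
  assumes "commuting_family S V \<rho>"
  shows "(\<Sum>i\<in>S. lie_mu scale (s i) bracket) \<le> dim V"
  using assms
proof (induction "dim V" arbitrary: S V \<rho> rule: less_induct)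
  case less
  note fam = less.prems
  note fin = commuting_familyD(2)[OF fam]
  have V: "stable (operators \<rho> S) V" using fam by (rule commuting_family_stable)
  have subV: "subspace V" using fam by (rule commuting_familyD)
  \<comment> \<open>The index \<open>i\<close> records that \<open>S\<close> is nonempty; in the
    last case this forces \<open>V \<noteq> {0}\<close>.\<close>
  consider "S = {}" | i where "i \<in> S" "irreducible (operators \<rho> S) V"
    | i where "i \<in> S" "\<not> irreducible (operators \<rho> S) V" by blast
  then show ?case
  proof cases
    case 1
    then show ?thesis by simp
  next
    case (2 i)
    show ?thesis
    proof (cases "S = {i}")
      case True
      obtain x v where xv: "x \<in> s i" "v \<in> V" "\<rho> x v \<noteq> 0"
        using commuting_familyD(6)[OF fam 2(1)] unfolding acts_nontrivially_def by blast
      interpret R: lie_representation scale "s i" bracket scaleV V \<rho>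
        using commuting_familyD(5)[OF fam 2(1)] .
      have "lie_mu scale (s i) bracket \<le> dim V"
        using R.simple_faithful[OF commuting_familyD(4)[OF fam 2(1)] xv] fin by (rule lie_mu_le_dim)
      then show ?thesis using True by simp
    next
      case False
      \<comment> \<open>\<open>{i}\<close> and \<open>T\<close> each get a space of at most half the
        dimension. The two spaces need not be complementary in \<open>V\<close>; just their
        dimensions are added.\<close>
      define T where "T = S - {i}"
      have T: "S = {i} \<union> T" "S = T \<union> {i}" "{i} \<inter> T = {}" "T \<inter> {i} = {}" "T \<noteq> {}"
        using 2(1) False by (auto simp: T_def)
      obtain U1 where U1: "commuting_family {i} U1 \<rho>" "2 * dim U1 \<le> dim V"
        by (rule commuting_subfamily_half_dim[of "{i}" T V \<rho>]) (use fam 2(2) T in auto)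
      obtain U2 where U2: "commuting_family T U2 \<rho>" "2 * dim U2 \<le> dim V"
        by (rule commuting_subfamily_half_dim[of T "{i}" V \<rho>]) (use fam 2(2) T in auto)
      \<comment> \<open>Positive dimension makes half of it strictly smaller, as the induction
        hypothesis requires.\<close>
      have "V \<noteq> {0}" using 2(2) by (simp add: irreducible_def)
      then have "dim V > 0" using finite_dim_dim_eq_0[OF fin subV] by auto
      then have "dim U1 < dim V" "dim U2 < dim V" using U1(2) U2(2) by auto
      then have "(\<Sum>i\<in>{i}. lie_mu scale (s i) bracket) \<le> dim U1"
        "(\<Sum>i\<in>T. lie_mu scale (s i) bracket) \<le> dim U2"
        using less.hyps[OF _ U1(1)] less.hyps[OF _ U2(1)] by blast+
      moreover have "(\<Sum>i\<in>S. lie_mu scale (s i) bracket) =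
          (\<Sum>i\<in>{i}. lie_mu scale (s i) bracket) + (\<Sum>i\<in>T. lie_mu scale (s i) bracket)"
        using commuting_familyD(3)[OF fam] T by (metis finite_Un sum.union_disjoint)
      ultimately show ?thesis using U1(2) U2(2) by linarith
    qed
  next
    case (3 i)
    have "V \<noteq> {0}"
    proof
      assume "V = {0}"
      obtain x v where xv: "x \<in> s i" "v \<in> V" "\<rho> x v \<noteq> 0"
        using commuting_familyD(6)[OF fam 3(1)] unfolding acts_nontrivially_def by blast
      then have "\<rho> x v \<in> V" using V 3(1) by (auto simp: stable_def)
      then show False using xv \<open>V = {0}\<close> by simp
    qed
    then obtain W where W: "stable (operators \<rho> S) W" "W \<subseteq> V" "W \<noteq> {0}" "W \<noteq> V"
      using 3(2) V unfolding irreducible_def by blast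
    have subW: "subspace W" using W(1) by (rule stable_subspace)
    have \<rho>W: "\<rho> x w \<in> W" if "i \<in> S" "x \<in> s i" "w \<in> W" for i x w
      using W(1) that by (auto simp: stable_def)
    obtain C p where p: "Vector_Spaces.linear scaleV scaleV p" and C: "subspace C" "C \<subseteq> V" "p ` V \<subseteq> C"
      and pW: "\<forall>w\<in>W. p w = 0" and "\<forall>v\<in>C. p v = v" and pV: "\<forall>v\<in>V. v - p v \<in> W"
      and dimV: "dim V = dim W + dim C"
      by (rule complement_projection[OF subV fin subW W(2)])
    have "dim W > 0"
      using finite_dim_dim_eq_0[OF finite_dim_subset[OF fin W(2)] subW] W(3) by auto
    moreover have "dim W < dim V"
      using finite_dim_subspace_eq[OF fin subW W(2)] W(4) by (meson not_less)
    ultimately have less: "dim W < dim V" "dim C < dim V" using dimV by auto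
    let ?q = "\<lambda>x v. p (\<rho> x v)"
    \<comment> \<open>The two index sets may overlap. Since \<open>lie_mu\<close> is a natural
      number, counting an index twice only enlarges the bound on the sum over
      \<open>S\<close>.\<close>
    define S1 S2 where "S1 = {i \<in> S. acts_nontrivially i W \<rho>}"
      and "S2 = {i \<in> S. acts_nontrivially i C ?q}"
    have "S \<subseteq> S1 \<union> S2"
    proof
      fix i assume i: "i \<in> S"
      interpret R: lie_representation scale "s i" bracket scaleV V \<rho>
        using commuting_familyD(5)[OF fam i] .
      show "i \<in> S1 \<union> S2"
      proof (rule ccontr)
        assume "i \<notin> S1 \<union> S2"
        then have triv: "\<rho> x w = 0" "p (\<rho> x v) = 0" if "x \<in> s i" "w \<in> W" "v \<in> C" for x w v
          using i that by (auto simp: S1_def S2_def acts_nontrivially_def)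
        \<comment> \<open>Trivial action on \<open>V / W\<close> sends \<open>V\<close> into
          \<open>W\<close>, and trivial action on \<open>W\<close> sends that to zero. So products
          of two operators of \<open>s i\<close> vanish, and these operators commute.\<close>
        have "\<rho> x (\<rho> y v) = 0" if "x \<in> s i" "y \<in> s i" "v \<in> V" for x y v
        proof -
          have v: "v - p v \<in> W" "p v \<in> C" "p v \<in> V" using that pV C by auto
          have y: "\<rho> y (p v) \<in> V" using that v by (simp add: R.rep_closed)
          have "\<rho> y v = \<rho> y ((v - p v) + p v)" by simp
          also have "\<dots> = \<rho> y (v - p v) + \<rho> y (p v)"
            using that v W(2) by (intro R.rep_add_vec) auto
          also have "\<dots> = \<rho> y (p v)" using triv(1) that v by simp
          also have "\<dots> \<in> W" using pV triv(2) that v y by force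
          finally show ?thesis using triv(1) that v by blast
        qed
        then show False
          using acts_nontrivially_if_brackets[OF fam i] by auto
      qed
    qed
    moreover have finS: "finite S1" "finite S2"
      using commuting_familyD(3)[OF fam] by (auto simp: S1_def S2_def)
    ultimately have "(\<Sum>i\<in>S. lie_mu scale (s i) bracket) \<le> (\<Sum>i\<in>S1 \<union> S2. lie_mu scale (s i) bracket)"
      by (intro sum_mono2) auto
    also have "\<dots> \<le> (\<Sum>i\<in>S1. lie_mu scale (s i) bracket) + (\<Sum>i\<in>S2. lie_mu scale (s i) bracket)"
      using sum.union_inter[OF finS, of "\<lambda>i. lie_mu scale (s i) bracket"] by linarith
    also have "\<dots> \<le> dim W + dim C"
    proof (rule add_mono)
      have "commuting_family S1 W \<rho>"
        using fam by (rule commuting_family_restrict)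
          (use W in \<open>auto simp: S1_def stable_def\<close>)
      then show "(\<Sum>i\<in>S1. lie_mu scale (s i) bracket) \<le> dim W"
        by (rule less.hyps[OF less(1)])
      have "commuting_family S2 C ?q"
        unfolding commuting_family_def
      proof (intro conjI ballI impI)
        show "subspace C" by (rule C)
        show "finite_dim scaleV C" using finite_dim_subset[OF fin C(2)] .
        show "finite S2" by (rule finS)
        fix i assume "i \<in> S2"
        then have i: "i \<in> S" "acts_nontrivially i C ?q" by (auto simp: S2_def)
        show "acts_nontrivially i C ?q" by (rule i)
        show "lie_algebra.simple scale (s i) bracket" using commuting_familyD(4)[OF fam i(1)] .
        show "lie_representation scale (s i) bracket scaleV C ?q"
          using commuting_familyD(5)[OF fam i(1)] p C W(2) \<rho>W[OF i(1)] pW pV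
          by (rule lie_representation.quotient_representation)
        fix j x y v assume jxyv: "j \<in> S2" "i \<noteq> j" "x \<in> s i" "y \<in> s j" "v \<in> C"
        then have j: "j \<in> S" by (simp add: S2_def)
        have v: "v \<in> V" using C jxyv by blast
        have p\<rho>: "p (\<rho> x (p u)) = p (\<rho> x u)" if "i \<in> S" "x \<in> s i" "u \<in> V" for i x u
        proof -
          have u: "u - p u \<in> W" "u \<in> V" "p u \<in> V" using pV C that by auto
          have "linear_on V (\<rho> x)" using that by (intro commuting_family_linear_on[OF fam]) auto
          then have "\<rho> x ((u - p u) + p u) = \<rho> x (u - p u) + \<rho> x (p u)"
            using u W(2) by (intro linear_on_add[of V]) auto
          moreover have "p (\<rho> x (u - p u)) = 0" using pW \<rho>W that u by blast
          ultimately show ?thesis using module_hom.add[OF p[folded module_hom_iff_linear]] by simp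
        qed
        have "\<rho> x v \<in> V" "\<rho> y v \<in> V" using V i(1) j jxyv v by (auto simp: stable_def)
        moreover have "\<rho> x (\<rho> y v) = \<rho> y (\<rho> x v)"
          using commuting_familyD(7)[OF fam i(1) j jxyv(2-4) v] .
        ultimately show "p (\<rho> x (p (\<rho> y v))) = p (\<rho> y (p (\<rho> x v)))"
          using p\<rho>[OF i(1) jxyv(3)] p\<rho>[OF j jxyv(4)] by simp
      qed
      then show "(\<Sum>i\<in>S2. lie_mu scale (s i) bracket) \<le> dim C"
        by (rule less.hyps[OF less(2)])
    qed
    also have "\<dots> = dim V" using dimV by simp
    finally show ?thesis .
  qed
qed

end

section \<open>Minimal faithful representations\<close>

text \<open>A basis of \<open>V\<close> is sent to unit sequences, and the action is conjugated by
  the resulting embedding \<open>f\<close> and its left inverse \<open>h\<close>. This makes the set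
  under the \<open>LEAST\<close> of \<open>lie_mu\<close> nonempty.\<close>

lemma ex_faithful_representation_on_sequences:
  assumes rep: "faithful_lie_representation scale L bracket scaleV V \<rho>"
    and fin: "finite_dim scaleV V"
  shows "\<exists>W \<sigma>. faithful_lie_representation scale L bracket seq_scale W \<sigma> \<and> finite_dim seq_scale W"
proof -
  interpret R: faithful_lie_representation scale L bracket scaleV V \<rho> by (rule rep)
  interpret S: vector_space seq_scale by (rule vector_space_seq_scale)
  interpret X: complex_vector_space scaleV ..
  interpret P: vector_space_pair scaleV seq_scale ..
  define e :: "nat \<Rightarrow> nat \<Rightarrow> complex" where "e = (\<lambda>i j. if j = i then 1 else 0)"
  have "inj e" by (rule injI) (metis e_def zero_neq_one)
  obtain B where B: "B \<subseteq> V" "R.rep.independent B" "V \<subseteq> R.rep.span B" "card B = R.rep.dim V"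
    by (rule R.rep.basis_exists[of V])
  have finB: "finite B" using fin B(1,2) by (rule X.finite_dim_independent)
  have spanB: "R.rep.span B = V" using R.rep.span_subspace[OF B(1,3) R.subspace_rep] .
  obtain b :: "_ \<Rightarrow> nat" where b: "inj_on b B"
    using finB finite_imp_inj_to_nat_seg by metis
  obtain f where f: "Vector_Spaces.linear scaleV seq_scale f" "\<forall>x\<in>B. f x = e (b x)"
    using P.linear_independent_extend[OF B(2), of "\<lambda>x. e (b x)"] by blast
  interpret f: Vector_Spaces.linear scaleV seq_scale f by (rule f(1))
  have "inj_on (\<lambda>x. e (b x)) B"
    using comp_inj_on[OF b inj_on_subset[OF \<open>inj e\<close> subset_UNIV]] by (simp add: comp_def)
  then have injfB: "inj_on f B" using f(2) by (simp cong: inj_on_cong)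
  have "S.independent (range e)" using seq_unit_independent by (simp add: e_def)
  moreover have "f ` B \<subseteq> range e" using f(2) by auto
  ultimately have "S.independent (f ` B)" by (rule S.independent_mono)
  then have injf: "inj_on f V"
    using f.inj_on_span_independent_image[of B] injfB spanB by simp
  obtain h where h: "Vector_Spaces.linear seq_scale scaleV h" "\<forall>v\<in>V. h (f v) = v"
    using P.linear_exists_left_inverse_on[OF f(1) R.subspace_rep injf] by blast
  interpret h: Vector_Spaces.linear seq_scale scaleV h by (rule h(1))
  define \<sigma> where "\<sigma> x w = f (\<rho> x (h w))" for x w
  have "faithful_lie_representation scale L bracket seq_scale (f ` V) \<sigma>"
  proof unfold_locales
    show "S.subspace (f ` V)" using f.subspace_image[OF R.subspace_rep] .
    show "inj_on (\<lambda>x. restrict (\<sigma> x) (f ` V)) L"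
    proof (rule inj_onI)
      fix x y assume xy: "x \<in> L" "y \<in> L"
        and eq: "restrict (\<sigma> x) (f ` V) = restrict (\<sigma> y) (f ` V)"
      have "\<rho> x v = \<rho> y v" if v: "v \<in> V" for v
      proof (rule inj_onD[OF injf])
        show "f (\<rho> x v) = f (\<rho> y v)"
          using fun_cong[OF eq, of "f v"] v h(2) by (simp add: \<sigma>_def)
      qed (use xy v R.rep_closed in auto)
      then have "restrict (\<rho> x) V = restrict (\<rho> y) V" by auto
      then show "x = y" using inj_onD[OF R.faithful] xy by blast
    qed
  qed (auto simp: \<sigma>_def R.rep_closed f.add f.scale f.diff h.add h.scale
        R.rep_add_vec R.rep_scale_vec R.rep_add R.rep_scale R.rep_bracket h(2)[rule_format])
  moreover have "finite_dim seq_scale (f ` V)"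
    unfolding finite_dim_def using f.span_image[of B] spanB finB by blast
  ultimately show ?thesis by blast
qed

text \<open>\<open>LEAST\<close> is informative only over a nonempty set; one faithful
  finite-dimensional representation, on a space of any type, provides that.\<close>

lemma lie_mu_attained:
  assumes "faithful_lie_representation scale L bracket scaleV V \<rho>" "finite_dim scaleV V"
  shows "\<exists>W \<sigma>. faithful_lie_representation scale L bracket seq_scale W \<sigma> \<and>
    finite_dim seq_scale W \<and> vector_space.dim seq_scale W = lie_mu scale L bracket"
proof -
  have "\<exists>n W \<sigma>. faithful_lie_representation scale L bracket seq_scale W \<sigma> \<and>
    finite_dim seq_scale W \<and> vector_space.dim seq_scale W = n"
    using ex_faithful_representation_on_sequences[OF assms] by blast
  then show ?thesis unfolding lie_mu_def by (rule LeastI_ex)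
qed

text \<open>The Jacobi identity makes \<open>bracket\<close> a representation of \<open>L\<close> on
  itself, and a nonzero bracket makes it faithful.\<close>

lemma (in lie_algebra) simple_adjoint_faithful:
  assumes simple
  shows "faithful_lie_representation scale L bracket scale L bracket"
proof -
  obtain x y where xy: "x \<in> L" "y \<in> L" "bracket x y \<noteq> 0"
    using assms unfolding simple_def abelian_def by blast
  have "lie_representation scale L bracket scale L bracket"
  proof unfold_locales
    fix x y v assume xyv: "x \<in> L" "y \<in> L" "v \<in> L"
    have "bracket (bracket x y) v = - bracket v (bracket x y)"
      using xyv by (intro bracket_anticommute bracket_closed)
    moreover have "bracket y (bracket v x) = - bracket y (bracket x v)"
      using xyv bracket_anticommute[of v x] bracket_scale_right[of y "bracket x v" "- 1"]
      by (simp add: bracket_closed)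
    moreover have "bracket x (bracket y v) + bracket y (bracket v x) = - bracket v (bracket x y)"
      using jacobi[OF xyv] by (simp add: eq_neg_iff_add_eq_0)
    ultimately show "bracket (bracket x y) v = bracket x (bracket y v) - bracket y (bracket x v)"
      by simp
  qed (simp_all add: subspace_carrier bracket_closed bracket_add_left bracket_add_right
      bracket_scale_left bracket_scale_right)
  then show ?thesis using assms xy by (rule lie_representation.simple_faithful)
qed

section \<open>Direct sums\<close>

locale lie_direct_sum = lie_algebra scale L bracket
  for scale :: "complex \<Rightarrow> 'a::ab_group_add \<Rightarrow> 'a" and L bracket +
  fixes I :: "'i set" and s :: "'i \<Rightarrow> 'a set"
  assumes finite_index: "finite I"
    and ideal: "i \<in> I \<Longrightarrow> lie_ideal (s i)"
    and direct_sum: "internal_direct_sum I s L"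
begin

text \<open>The inverse of the summation bijection, meaningful for elements of \<open>L\<close> and
  indices in \<open>I\<close>.\<close>

definition component :: "'a \<Rightarrow> 'i \<Rightarrow> 'a"
  where "component = inv_into (Pi\<^sub>E I s) (\<lambda>f. \<Sum>i\<in>I. f i)"

lemma component_in:
  assumes "x \<in> L" "i \<in> I"
  shows "component x i \<in> s i"
proof -
  have "component x \<in> Pi\<^sub>E I s"
    unfolding component_def using assms direct_sum
    by (intro inv_into_into) (simp add: internal_direct_sum_def bij_betw_def)
  then show ?thesis using assms by blast
qed

lemma ideal_subset: "i \<in> I \<Longrightarrow> x \<in> s i \<Longrightarrow> x \<in> L"
  using ideal lie_idealD(2) by blast

lemma sum_component:
  assumes "x \<in> L"
  shows "(\<Sum>i\<in>I. component x i) = x"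
  unfolding component_def using assms direct_sum f_inv_into_f[of x "\<lambda>f. \<Sum>i\<in>I. f i" "Pi\<^sub>E I s"]
  by (simp add: internal_direct_sum_def bij_betw_def)

text \<open>Uniqueness of the decomposition; \<open>f\<close> is first restricted to
  \<open>I\<close> because \<open>Pi\<^sub>E I s\<close> has only extensional members. Components
  are computed below by exhibiting a decomposition.\<close>

lemma component_sum:
  assumes f: "\<And>i. i \<in> I \<Longrightarrow> f i \<in> s i" and i: "i \<in> I"
  shows "component (\<Sum>i\<in>I. f i) i = f i"
proof -
  let ?f = "restrict f I"
  have "component (\<Sum>i\<in>I. ?f i) = ?f"
    unfolding component_def using direct_sum f
    by (intro inv_into_f_f) (auto simp: internal_direct_sum_def bij_betw_def)
  moreover have "(\<Sum>i\<in>I. ?f i) = (\<Sum>i\<in>I. f i)" by simp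
  ultimately show ?thesis using i by simp
qed

lemma component_add:
  assumes "x \<in> L" "y \<in> L" "i \<in> I"
  shows "component (x + y) i = component x i + component y i"
proof -
  have "component (\<Sum>i\<in>I. component x i + component y i) i = component x i + component y i"
    using assms component_in lie_idealD(1)[OF ideal]
    by (intro component_sum subspace_add[of "s _"]) auto
  then show ?thesis using assms by (simp add: sum.distrib sum_component)
qed

lemma component_scale:
  assumes "x \<in> L" "i \<in> I"
  shows "component (scale c x) i = scale c (component x i)"
proof -
  have "component (\<Sum>i\<in>I. scale c (component x i)) i = scale c (component x i)"
    using assms component_in lie_idealD(1)[OF ideal]
    by (intro component_sum subspace_scale[of "s _"]) auto
  then show ?thesis using assms by (simp add: sum_component flip: scale_sum_right)
qed

lemma component_of_summand:
  assumes "i \<in> I" "x \<in> s i" "j \<in> I"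
  shows "component x j = (if j = i then x else 0)"
proof -
  have "component (\<Sum>j\<in>I. if j = i then x else 0) j = (if j = i then x else 0)"
    using assms subspace_0[OF lie_idealD(1)[OF ideal]] by (intro component_sum) auto
  then show ?thesis using assms finite_index by simp
qed

text \<open>The bracket lies in both ideals. As an element of \<open>s i\<close> it is its own
  component at \<open>i\<close>; as an element of \<open>s j\<close> it has component zero
  there.\<close>

lemma bracket_summands:
  assumes "i \<in> I" "j \<in> I" "i \<noteq> j" "x \<in> s i" "y \<in> s j"
  shows "bracket x y = 0"
proof -
  have "bracket x y \<in> s i" "bracket x y \<in> s j"
    using assms lie_idealD(3)[OF ideal] lie_idealD(4)[OF ideal] ideal_subset by blast+
  then show ?thesis
    using component_of_summand[of i "bracket x y" i] component_of_summand[of j "bracket x y" i] assms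
    by simp
qed

lemma bracket_sum_left:
  assumes "finite J" "\<And>i. i \<in> J \<Longrightarrow> f i \<in> L" "y \<in> L"
  shows "bracket (\<Sum>i\<in>J. f i) y = (\<Sum>i\<in>J. bracket (f i) y)"
  using assms
proof (induction J rule: finite_induct)
  case (insert i J)
  then have "(\<Sum>i\<in>J. f i) \<in> L" by (intro subspace_sum[OF subspace_carrier]) auto
  then show ?case using insert by (simp add: bracket_add_left)
qed simp

lemma bracket_sum_right:
  assumes "finite J" "\<And>i. i \<in> J \<Longrightarrow> f i \<in> L" "y \<in> L"
  shows "bracket y (\<Sum>i\<in>J. f i) = (\<Sum>i\<in>J. bracket y (f i))"
  using assms
proof (induction J rule: finite_induct)
  case (insert i J)
  then have "(\<Sum>i\<in>J. f i) \<in> L" by (intro subspace_sum[OF subspace_carrier]) auto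
  then show ?case using insert by (simp add: bracket_add_right)
qed simp

text \<open>Brackets between different summands vanish, so only the diagonal terms survive when both
  arguments are decomposed.\<close>

lemma component_bracket:
  assumes "x \<in> L" "y \<in> L" "i \<in> I"
  shows "component (bracket x y) i = bracket (component x i) (component y i)"
proof -
  have L: "component z i \<in> L" if "z \<in> L" "i \<in> I" for z i
    using ideal_subset component_in that by blast
  have "bracket (component x i) y = bracket (component x i) (component y i)" if "i \<in> I" for i
  proof -
    have "bracket (component x i) y = bracket (component x i) (\<Sum>j\<in>I. component y j)"
      using assms by (simp add: sum_component)
    also have "\<dots> = (\<Sum>j\<in>I. bracket (component x i) (component y j))"
      using finite_index L assms that by (intro bracket_sum_right)
    also have "\<dots> = (\<Sum>j\<in>I. if j = i then bracket (component x i) (component y i) else 0)"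
      using assms that by (intro sum.cong) (auto intro: bracket_summands component_in)
    also have "\<dots> = bracket (component x i) (component y i)"
      using that finite_index by simp
    finally show ?thesis .
  qed
  moreover have "bracket x y = (\<Sum>i\<in>I. bracket (component x i) y)"
    using bracket_sum_left[OF finite_index, of "component x" y] L assms by (simp add: sum_component)
  ultimately have "bracket x y = (\<Sum>i\<in>I. bracket (component x i) (component y i))" by simp
  moreover have "bracket (component x i) (component y i) \<in> s i" if "i \<in> I" for i
    using that assms by (intro lie_idealD(3)[OF ideal] L component_in)
  ultimately show ?thesis
    using assms(3) component_sum[of "\<lambda>i. bracket (component x i) (component y i)" i] by simp
qed

end

section \<open>The block-diagonal representation on an external direct sum\<close>

definition fun_scale :: "(complex \<Rightarrow> 'v \<Rightarrow> 'v) \<Rightarrow> complex \<Rightarrow> ('i \<Rightarrow> 'v) \<Rightarrow> 'i \<Rightarrow> 'v"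
  where "fun_scale scaleV c f = (\<lambda>i. scaleV c (f i))"

lemma vector_space_fun_scale:
  assumes "vector_space scaleV"
  shows "vector_space (fun_scale scaleV)"
proof -
  interpret vector_space scaleV by (rule assms)
  show ?thesis
    by unfold_locales (auto simp: fun_scale_def plus_fun_def scale_right_distrib scale_left_distrib)
qed

text \<open>\<open>L\<close> acts on block \<open>i\<close> through \<open>component\<close>, and
  faithfulness holds because the components determine \<open>x\<close>. For a minimum, an upper
  bound on the dimension suffices.\<close>

lemma (in lie_direct_sum) direct_sum_representation:
  fixes scaleV :: "complex \<Rightarrow> 'v::ab_group_add \<Rightarrow> 'v"
  assumes V: "vector_space scaleV"
    and rep: "\<And>i. i \<in> I \<Longrightarrow> faithful_lie_representation scale (s i) bracket scaleV (W i) (\<rho> i)"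
    and fin: "\<And>i. i \<in> I \<Longrightarrow> finite_dim scaleV (W i)"
  shows "\<exists>(U :: ('i \<Rightarrow> 'v) set) \<sigma>.
    faithful_lie_representation scale L bracket (fun_scale scaleV) U \<sigma> \<and>
    finite_dim (fun_scale scaleV) U \<and>
    vector_space.dim (fun_scale scaleV) U \<le> (\<Sum>i\<in>I. vector_space.dim scaleV (W i))"
proof -
  interpret S: vector_space scaleV by (rule V)
  interpret F: vector_space "fun_scale scaleV :: complex \<Rightarrow> ('i \<Rightarrow> 'v) \<Rightarrow> 'i \<Rightarrow> 'v"
    using V by (rule vector_space_fun_scale)
  interpret X: complex_vector_space scaleV ..
  \<comment> \<open>Vanishing outside \<open>I\<close> makes each \<open>f\<close> in
    \<open>U\<close> the finite sum of its blocks \<open>single i (f i)\<close>, so the embedded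
    bases collected in \<open>D\<close> span \<open>U\<close>.\<close>
  define U where "U = {f. (\<forall>i\<in>I. f i \<in> W i) \<and> (\<forall>i. i \<notin> I \<longrightarrow> f i = 0)}"
  define \<sigma> where "\<sigma> x f i = (if i \<in> I then \<rho> i (component x i) (f i) else 0)" for x f i
  define single :: "'i \<Rightarrow> 'v \<Rightarrow> 'i \<Rightarrow> 'v" where "single i v = (\<lambda>j. if j = i then v else 0)" for i v
  have "\<exists>B. finite B \<and> W i \<subseteq> S.span B \<and> card B = S.dim (W i)" if "i \<in> I" for i
  proof -
    obtain B where "B \<subseteq> W i" "S.independent B" "W i \<subseteq> S.span B" "card B = S.dim (W i)"
      by (rule S.basis_exists[of "W i"])
    then show ?thesis using X.finite_dim_independent(1)[OF fin[OF that]] by blast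
  qed
  then obtain B where B: "\<And>i. i \<in> I \<Longrightarrow> finite (B i) \<and> W i \<subseteq> S.span (B i) \<and> card (B i) = S.dim (W i)"
    by metis
  define D where "D = (\<Union>i\<in>I. single i ` B i)"
  have "finite D" unfolding D_def using finite_index B by auto
  have spanU: "U \<subseteq> F.span D"
  proof
    fix f assume f: "f \<in> U"
    have "single i (f i) \<in> F.span D" if i: "i \<in> I" for i
    proof -
      have "single i v \<in> F.span D" if "v \<in> S.span (B i)" for v
        using that
      proof (induction rule: S.span_induct_alt)
        case base
        have "single i 0 = 0" by (auto simp: single_def)
        then show ?case using F.span_zero by metis
      next
        case (step c b v)
        have "single i (scaleV c b + v) = fun_scale scaleV c (single i b) + single i v"
          by (auto simp: single_def fun_scale_def)
        also have "\<dots> \<in> F.span D"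
        proof (rule F.span_add[OF F.span_scale[OF F.span_base] step(2)])
          show "single i b \<in> D" using step(1) i by (auto simp: D_def)
        qed
        finally show ?case .
      qed
      then show ?thesis using f i B by (auto simp: U_def)
    qed
    moreover have "f = (\<Sum>i\<in>I. single i (f i))"
    proof
      fix j
      have "(\<Sum>i\<in>I. single i (f i)) j = (\<Sum>i\<in>I. single i (f i) j)"
        using finite_index by (induction I rule: finite_induct) auto
      also have "\<dots> = (\<Sum>i\<in>I. if j = i then f j else 0)"
        by (intro sum.cong) (auto simp: single_def)
      also have "\<dots> = f j" using finite_index f by (auto simp: U_def)
      finally show "f j = (\<Sum>i\<in>I. single i (f i)) j" by simp
    qed
    ultimately show "f \<in> F.span D" using F.span_sum[of I "\<lambda>i. single i (f i)" D] by simp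
  qed
  have "F.dim U \<le> card D" using spanU \<open>finite D\<close> by (rule F.dim_le_card)
  also have "\<dots> \<le> (\<Sum>i\<in>I. card (single i ` B i))"
    unfolding D_def using finite_index by (rule card_UN_le)
  also have "\<dots> \<le> (\<Sum>i\<in>I. S.dim (W i))"
  proof (rule sum_mono)
    fix i assume "i \<in> I"
    then show "card (single i ` B i) \<le> S.dim (W i)" using B card_image_le[of "B i" "single i"] by simp
  qed
  finally have dimU: "F.dim U \<le> (\<Sum>i\<in>I. S.dim (W i))" .
  have R: "lie_representation scale (s i) bracket scaleV (W i) (\<rho> i)" if "i \<in> I" for i
    using rep[OF that] by (rule faithful_lie_representation.axioms)
  have W: "S.subspace (W i)" if "i \<in> I" for i
    using R[OF that] by (rule lie_representation.subspace_rep)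
  have "faithful_lie_representation scale L bracket (fun_scale scaleV) U \<sigma>"
  proof unfold_locales
    show "F.subspace U"
      by (rule F.subspaceI)
        (auto simp: U_def fun_scale_def S.subspace_0 S.subspace_add S.subspace_scale W)
    show "\<sigma> x f \<in> U" if "x \<in> L" "f \<in> U" for x f
      using that component_in
      by (auto simp: U_def \<sigma>_def intro: lie_representation.rep_closed[OF R])
    show "\<sigma> x (f + g) = \<sigma> x f + \<sigma> x g" if "x \<in> L" "f \<in> U" "g \<in> U" for x f g
      using that component_in
      by (auto simp: U_def \<sigma>_def fun_eq_iff intro: lie_representation.rep_add_vec[OF R])
    show "\<sigma> x (fun_scale scaleV c f) = fun_scale scaleV c (\<sigma> x f)" if "x \<in> L" "f \<in> U" for x c f
      using that component_in
      by (auto simp: U_def \<sigma>_def fun_eq_iff fun_scale_def intro: lie_representation.rep_scale_vec[OF R])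
    show "\<sigma> (x + y) f = \<sigma> x f + \<sigma> y f" if "x \<in> L" "y \<in> L" "f \<in> U" for x y f
      using that component_in
      by (auto simp: U_def \<sigma>_def fun_eq_iff component_add intro: lie_representation.rep_add[OF R])
    show "\<sigma> (scale c x) f = fun_scale scaleV c (\<sigma> x f)" if "x \<in> L" "f \<in> U" for c x f
      using that component_in
      by (auto simp: U_def \<sigma>_def fun_eq_iff fun_scale_def component_scale
          intro: lie_representation.rep_scale[OF R])
    show "\<sigma> (bracket x y) f = \<sigma> x (\<sigma> y f) - \<sigma> y (\<sigma> x f)" if "x \<in> L" "y \<in> L" "f \<in> U" for x y f
      using that component_in
      by (auto simp: U_def \<sigma>_def fun_eq_iff component_bracket
          intro: lie_representation.rep_bracket[OF R])
    show "inj_on (\<lambda>x. restrict (\<sigma> x) U) L"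
    proof (rule inj_onI)
      fix x y assume xy: "x \<in> L" "y \<in> L" and eq: "restrict (\<sigma> x) U = restrict (\<sigma> y) U"
      have "component x i = component y i" if i: "i \<in> I" for i
      proof (rule inj_onD[OF faithful_lie_representation.faithful[OF rep[OF i]]])
        have "\<rho> i (component x i) v = \<rho> i (component y i) v" if v: "v \<in> W i" for v
        proof -
          \<comment> \<open>Vectors supported in block \<open>i\<close> alone isolate the operator
            of the component at \<open>i\<close>.\<close>
          have "single i v \<in> U" using v i W by (auto simp: U_def single_def S.subspace_0)
          then have "\<sigma> x (single i v) = \<sigma> y (single i v)"
            using fun_cong[OF eq, of "single i v"] by simp
          from fun_cong[OF this, of i] show ?thesis using i by (simp add: \<sigma>_def single_def)
        qed
        then show "restrict (\<rho> i (component x i)) (W i) = restrict (\<rho> i (component y i)) (W i)"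
          by auto
      qed (use xy i component_in in auto)
      then have "(\<Sum>i\<in>I. component x i) = (\<Sum>i\<in>I. component y i)" by simp
      then show "x = y" using xy by (simp add: sum_component)
    qed
  qed
  moreover have "finite_dim (fun_scale scaleV) U"
    unfolding finite_dim_def using spanU \<open>finite D\<close> by blast
  ultimately show ?thesis using dimU by blast
qed

theorem proposition2p9:
  fixes scale :: "complex \<Rightarrow> 'a::ab_group_add \<Rightarrow> 'a"
    and bracket :: "'a \<Rightarrow> 'a \<Rightarrow> 'a"
    and \<gg> :: "'a set"
    and s :: "nat \<Rightarrow> 'a set"
    and l :: nat
  assumes "lie_algebra scale \<gg> bracket"
    and "finite_dim scale \<gg>"
    and "lie_algebra.semisimple scale \<gg> bracket"
    and "\<And>i. i \<in> {1..l} \<Longrightarrow> lie_algebra.lie_ideal scale \<gg> bracket (s i)"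
    and "\<And>i. i \<in> {1..l} \<Longrightarrow> lie_algebra.simple scale (s i) bracket"
    and "internal_direct_sum {1..l} s \<gg>"
  shows "lie_mu scale \<gg> bracket = (\<Sum>i=1..l. lie_mu scale (s i) bracket)"
proof -
  interpret lie_direct_sum scale \<gg> bracket "{1..l}" s
    using assms by (intro lie_direct_sum.intro lie_direct_sum_axioms.intro) auto
  let ?mu = "\<lambda>i. lie_mu scale (s i) bracket"
  have simple: "lie_algebra scale (s i) bracket" "lie_algebra.simple scale (s i) bracket"
    if "i \<in> {1..l}" for i
    using lie_ideal_lie_algebra[OF ideal[OF that]] assms(5)[OF that] .
  \<comment> \<open>The adjoint representation of \<open>s i\<close> ensures that the minimum is
    attained.\<close>
  have "\<exists>W \<rho>. faithful_lie_representation scale (s i) bracket seq_scale W \<rho> \<and>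
      finite_dim seq_scale W \<and> vector_space.dim seq_scale W = ?mu i" if i: "i \<in> {1..l}" for i
  proof (rule lie_mu_attained)
    show "faithful_lie_representation scale (s i) bracket scale (s i) bracket"
      using simple[OF i] by (rule lie_algebra.simple_adjoint_faithful)
    show "finite_dim scale (s i)"
      using assms(2) lie_idealD(2)[OF ideal[OF i]] unfolding finite_dim_def by blast
  qed
  then obtain W \<rho> where W: "\<And>i. i \<in> {1..l} \<Longrightarrow>
      faithful_lie_representation scale (s i) bracket seq_scale (W i) (\<rho> i) \<and>
      finite_dim seq_scale (W i) \<and> vector_space.dim seq_scale (W i) = ?mu i"
    by metis
  \<comment> \<open>The blocks are spaces of sequences, so their sum consists of families of
    sequences; \<open>lie_mu_le_dim\<close> turns its dimension into a bound on
    \<open>lie_mu\<close>.\<close>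
  have "\<exists>(U :: (nat \<Rightarrow> nat \<Rightarrow> complex) set) \<sigma>.
      faithful_lie_representation scale \<gg> bracket (fun_scale seq_scale) U \<sigma> \<and>
      finite_dim (fun_scale seq_scale) U \<and>
      vector_space.dim (fun_scale seq_scale) U \<le> (\<Sum>i=1..l. vector_space.dim seq_scale (W i))"
    using W by (intro direct_sum_representation[OF vector_space_seq_scale, of W \<rho>]) auto
  then obtain U :: "(nat \<Rightarrow> nat \<Rightarrow> complex) set" and \<sigma>
    where U: "faithful_lie_representation scale \<gg> bracket (fun_scale seq_scale) U \<sigma>"
      "finite_dim (fun_scale seq_scale) U"
      "vector_space.dim (fun_scale seq_scale) U \<le> (\<Sum>i=1..l. vector_space.dim seq_scale (W i))"
    by blast
  have "(\<Sum>i=1..l. vector_space.dim seq_scale (W i)) = (\<Sum>i=1..l. ?mu i)"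
    using W by (intro sum.cong) auto
  then have upper: "lie_mu scale \<gg> bracket \<le> (\<Sum>i=1..l. ?mu i)"
    using lie_mu_le_dim[OF U(1,2)] U(3) by linarith
  \<comment> \<open>\<open>U\<close> also witnesses that \<gg> has a faithful finite-dimensional
    representation, so one of minimal dimension exists.\<close>
  obtain V \<tau> where V: "faithful_lie_representation scale \<gg> bracket seq_scale V \<tau>"
    "finite_dim seq_scale V" "vector_space.dim seq_scale V = lie_mu scale \<gg> bracket"
    using lie_mu_attained[OF U(1,2)] by blast
  interpret T: faithful_lie_representation scale \<gg> bracket seq_scale V \<tau> by (rule V(1))
  interpret F: simple_lie_family seq_scale scale bracket s
    by (intro simple_lie_family.intro complex_vector_space.intro vector_space_seq_scale)
  have "F.commuting_family {1..l} V \<tau>"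
    unfolding F.commuting_family_def
  proof (intro conjI ballI impI)
    show "finite {1..l}" by simp
    show "T.rep.subspace V" by (rule T.subspace_rep)
    show "finite_dim seq_scale V" by (rule V)
    fix i assume i: "i \<in> {1..l}"
    show "lie_algebra.simple scale (s i) bracket" using i by (rule assms(5))
    interpret Si: lie_algebra scale "s i" bracket using simple(1)[OF i] .
    show "lie_representation scale (s i) bracket seq_scale V \<tau>"
      using T.subspace_rep ideal_subset[OF i]
      by unfold_locales (auto simp: T.rep_closed T.rep_add_vec T.rep_scale_vec T.rep_add T.rep_scale
          T.rep_bracket)
    show "F.acts_nontrivially i V \<tau>"
    proof (rule ccontr)
      assume triv: "\<not> F.acts_nontrivially i V \<tau>"
      \<comment> \<open>If \<open>s i\<close> acted trivially, each of its elements would act like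
        \<open>0\<close>; faithfulness on \<gg> would then make \<open>s i\<close> zero and hence
        abelian.\<close>
      have zero: "x = 0" if x: "x \<in> s i" for x
      proof (rule inj_onD[OF T.faithful])
        show "restrict (\<tau> x) V = restrict (\<tau> 0) V"
          using triv x by (auto simp: F.acts_nontrivially_def T.rep_zero fun_eq_iff)
      qed (use x ideal_subset[OF i] subspace_0[OF subspace_carrier] in auto)
      then have "Si.abelian" unfolding Si.abelian_def using Si.bracket_closed by blast
      then show False using simple(2)[OF i] unfolding Si.simple_def by blast
    qed
    fix j x y v assume j: "j \<in> {1..l}" "i \<noteq> j" "x \<in> s i" "y \<in> s j" "v \<in> V"
    have "\<tau> (bracket x y) v = \<tau> x (\<tau> y v) - \<tau> y (\<tau> x v)"
      using ideal_subset i j by (intro T.rep_bracket) auto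
    moreover have "bracket x y = 0" using i j by (intro bracket_summands)
    ultimately show "\<tau> x (\<tau> y v) = \<tau> y (\<tau> x v)" using T.rep_zero[OF j(5)] by simp
  qed
  then have "(\<Sum>i=1..l. ?mu i) \<le> vector_space.dim seq_scale V"
    by (rule F.sum_lie_mu_le_dim)
  then show ?thesis using upper V(3) by linarith
qed

end
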